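(* Let $(R,\mathfrak m)$ be a commutative Noetherian local ring and let $M$ be a finitely generated $R$-module of dimension $d\ge 1$. Let $\mathfrak q$ be an ideal of $R$ generated by a system of parameters on $M$, and put $c=\ell(M/\mathfrak qM)$. Then, for any submodule $N$ of $M$ with $\operatorname{depth}(M/N)\ge d-1$, we have $\mu(N)\le c$.
   Context: All rings are commutative Noetherian with non-zero identity. $\ell(K)$ denotes the length and $\mu(K)$ the minimal number of generators of an $R$-module $K$. For a finitely generated $R$-module $M$ of dimension $d$ over a local ring $(R,\mathfrak m)$, a system of parameters on $M$ is a sequence $x_1,\dots,x_d\in\mathfrak m$ such that $M/(x_1,\dots,x_d)M$ has finite length. *)

theory Defs
  imports "HOL-Algebra.Module" "HOL-Algebra.Ring_Divisibility" "HOL-Library.Extended_Nat"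
begin

locale local_ring = cring R + maximalideal \<mm> R for R (structure) and \<mm> +
  assumes maximal_unique: "maximalideal I R \<Longrightarrow> I = \<mm>"

definition gen_submodule ::
    "('a, 'r) ring_scheme \<Rightarrow> ('a, 'b, 'm) module_scheme \<Rightarrow> 'b set \<Rightarrow> 'b set"
  where "gen_submodule R M S = \<Inter>{H. submodule H R M \<and> S \<subseteq> H}"

definition finitely_generated ::
    "('a, 'r) ring_scheme \<Rightarrow> ('a, 'b, 'm) module_scheme \<Rightarrow> bool"
  where "finitely_generated R M \<longleftrightarrow>
    (\<exists>S. S \<subseteq> carrier M \<and> finite S \<and> gen_submodule R M S = carrier M)"

text \<open>The infimum is \<open>\<infinity>\<close> if the module is not finitely generated.\<close>

definition min_gens ::
    "('a, 'r) ring_scheme \<Rightarrow> ('a, 'b, 'm) module_scheme \<Rightarrow> enat"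
  where "min_gens R M =
    Inf {enat (card S) | S. S \<subseteq> carrier M \<and> finite S \<and> gen_submodule R M S = carrier M}"

definition module_length ::
    "('a, 'r) ring_scheme \<Rightarrow> ('a, 'b, 'm) module_scheme \<Rightarrow> enat"
  where "module_length R M =
    Sup {enat n | n. \<exists>C :: nat \<Rightarrow> 'b set.
      (\<forall>i\<le>n. submodule (C i) R M) \<and> (\<forall>i<n. C i \<subset> C (Suc i))}"

definition ideal_times ::
    "('a, 'r) ring_scheme \<Rightarrow> 'a set \<Rightarrow> ('a, 'b, 'm) module_scheme \<Rightarrow> 'b set"
  where "ideal_times R I M =
    gen_submodule R M {a \<odot>\<^bsub>M\<^esub> x | a x. a \<in> I \<and> x \<in> carrier M}"

text \<open>Module records extend ring records, so the quotient needs values for the fields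
  \<open>mult\<close> and \<open>one\<close>, which play no role for modules.\<close>

definition quot_module :: "('a, 'b, 'm) module_scheme \<Rightarrow> 'b set \<Rightarrow> ('a, 'b set) module"
  where "quot_module M N =
    \<lparr>carrier = a_rcosets\<^bsub>M\<^esub> N, monoid.mult = (\<lambda>_ _. undefined), one = undefined,
     ring.zero = N, add = set_add M, smult = (\<lambda>a A. \<Union>x\<in>A. N +>\<^bsub>M\<^esub> (a \<odot>\<^bsub>M\<^esub> x))\<rparr>"

definition annihilator ::
    "('a, 'r) ring_scheme \<Rightarrow> ('a, 'b, 'm) module_scheme \<Rightarrow> 'a set"
  where "annihilator R M = {a \<in> carrier R. \<forall>x\<in>carrier M. a \<odot>\<^bsub>M\<^esub> x = \<zero>\<^bsub>M\<^esub>}"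

text \<open>The Krull dimension of the zero ring, and hence the dimension of the zero module, is
  \<open>Sup {} = 0\<close> here, instead of the customary \<open>-1\<close> or \<open>-\<infinity>\<close>.\<close>

definition krull_dim :: "('a, 'r) ring_scheme \<Rightarrow> enat"
  where "krull_dim R =
    Sup {enat n | n. \<exists>P :: nat \<Rightarrow> 'a set.
      (\<forall>i\<le>n. primeideal (P i) R) \<and> (\<forall>i<n. P i \<subset> P (Suc i))}"

definition module_dim ::
    "('a, 'r) ring_scheme \<Rightarrow> ('a, 'b, 'm) module_scheme \<Rightarrow> enat"
  where "module_dim R M = krull_dim (R Quot (annihilator R M))"

definition system_of_parameters ::
    "('a, 'r) ring_scheme \<Rightarrow> 'a set \<Rightarrow> ('a, 'b, 'm) module_scheme \<Rightarrow> 'a list \<Rightarrow> bool"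
  where "system_of_parameters R \<mm> M xs \<longleftrightarrow>
    set xs \<subseteq> \<mm> \<and> enat (length xs) = module_dim R M \<and>
    module_length R (quot_module M (ideal_times R (Idl\<^bsub>R\<^esub> (set xs)) M)) < \<infinity>"

definition nonzerodivisor_on :: "('a, 'b, 'm) module_scheme \<Rightarrow> 'a \<Rightarrow> bool"
  where "nonzerodivisor_on M a \<longleftrightarrow>
    (\<forall>x\<in>carrier M. a \<odot>\<^bsub>M\<^esub> x = \<zero>\<^bsub>M\<^esub> \<longrightarrow> x = \<zero>\<^bsub>M\<^esub>)"

definition regular_sequence ::
    "('a, 'r) ring_scheme \<Rightarrow> ('a, 'b, 'm) module_scheme \<Rightarrow> 'a list \<Rightarrow> bool"
  where "regular_sequence R M xs \<longleftrightarrow>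
    set xs \<subseteq> carrier R \<and>
    (\<forall>i<length xs. nonzerodivisor_on
       (quot_module M (ideal_times R (Idl\<^bsub>R\<^esub> (set (take i xs))) M)) (xs ! i)) \<and>
    ideal_times R (Idl\<^bsub>R\<^esub> (set xs)) M \<noteq> carrier M"

text \<open>The zero module has no regular sequences, not even the empty one; its depth is \<open>\<infinity>\<close> by
  convention.\<close>

definition depth ::
    "('a, 'r) ring_scheme \<Rightarrow> 'a set \<Rightarrow> ('a, 'b, 'm) module_scheme \<Rightarrow> enat"
  where "depth R \<mm> M =
    (if carrier M = {\<zero>\<^bsub>M\<^esub>} then \<infinity>
     else Sup {enat (length xs) | xs. set xs \<subseteq> \<mm> \<and> regular_sequence R M xs})"


context module
begin

lemma gen_submodule_submodule:
  assumes "S \<subseteq> carrier M"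
  shows "submodule (gen_submodule R M S) R M"
proof (rule submoduleI)
  show "gen_submodule R M S \<subseteq> carrier M"
    using assms carrier_is_submodule unfolding gen_submodule_def by blast
next
  show "\<zero>\<^bsub>M\<^esub> \<in> gen_submodule R M S"
    unfolding gen_submodule_def
    by (auto dest!: submodule.axioms(1) subgroup.one_closed)
qed (auto simp: gen_submodule_def dest: submoduleE)

lemma ideal_times_submodule:
  assumes "I \<subseteq> carrier R"
  shows "submodule (ideal_times R I M) R M"
  unfolding ideal_times_def using assms by (intro gen_submodule_submodule) auto

lemma annihilator_ideal: "ideal (annihilator R M) R"
proof (rule idealI)
  show "subgroup (annihilator R M) (add_monoid R)"
  proof (rule R.add.subgroupI)
    show "annihilator R M \<noteq> {}"
      using R.zero_closed smult_l_null unfolding annihilator_def by blast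
  qed (auto simp: annihilator_def smult_l_minus smult_l_distr simp flip: a_inv_def)
  show "x \<otimes>\<^bsub>R\<^esub> a \<in> annihilator R M" if "a \<in> annihilator R M" "x \<in> carrier R" for a x
    using that by (auto simp: annihilator_def smult_assoc1)
  then show "a \<otimes>\<^bsub>R\<^esub> x \<in> annihilator R M" if "a \<in> annihilator R M" "x \<in> carrier R" for a x
    using that by (metis (no_types, lifting) R.m_comm annihilator_def mem_Collect_eq)
qed (rule R.ring_axioms)

lemma quot_module_module:
  assumes N: "submodule N R M"
  shows "module R (quot_module M N)"
proof -
  interpret N: abelian_subgroup N M
    using N submodule.axioms(1)
    by (intro abelian_subgroupI3 M.abelian_group_axioms)
       (auto simp: additive_subgroup_def)
  have smult: "(\<Union>y\<in>N +>\<^bsub>M\<^esub> x. N +>\<^bsub>M\<^esub> (a \<odot>\<^bsub>M\<^esub> y)) = N +>\<^bsub>M\<^esub> (a \<odot>\<^bsub>M\<^esub> x)"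
    if a: "a \<in> carrier R" and x: "x \<in> carrier M" for a x
  proof -
    have "N +>\<^bsub>M\<^esub> (a \<odot>\<^bsub>M\<^esub> y) = N +>\<^bsub>M\<^esub> (a \<odot>\<^bsub>M\<^esub> x)" if y: "y \<in> N +>\<^bsub>M\<^esub> x" for y
    proof -
      obtain h where h: "h \<in> N" "y = h \<oplus>\<^bsub>M\<^esub> x"
        using y by (auto simp: a_r_coset_def r_coset_def)
      have "a \<odot>\<^bsub>M\<^esub> y = a \<odot>\<^bsub>M\<^esub> h \<oplus>\<^bsub>M\<^esub> a \<odot>\<^bsub>M\<^esub> x"
        using h a x N.a_Hcarr by (simp add: smult_r_distr)
      moreover have "a \<odot>\<^bsub>M\<^esub> h \<in> N"
        using N a h by (auto dest: submoduleE(4))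
      ultimately have "a \<odot>\<^bsub>M\<^esub> y \<in> N +>\<^bsub>M\<^esub> (a \<odot>\<^bsub>M\<^esub> x)"
        using h by (auto simp: a_r_coset_def r_coset_def)
      then show ?thesis
        using a x by (metis N.a_repr_independence' smult_closed)
    qed
    moreover have "x \<in> N +>\<^bsub>M\<^esub> x"
      using x by (rule N.a_rcos_self)
    ultimately show ?thesis by blast
  qed
  define Q where "Q = quot_module M N"
  have carrier: "A \<in> carrier Q \<longleftrightarrow> (\<exists>x\<in>carrier M. A = N +>\<^bsub>M\<^esub> x)" for A
    by (auto simp: Q_def quot_module_def A_RCOSETS_def')
  have add: "(N +>\<^bsub>M\<^esub> x) \<oplus>\<^bsub>Q\<^esub> (N +>\<^bsub>M\<^esub> y) = N +>\<^bsub>M\<^esub> (x \<oplus>\<^bsub>M\<^esub> y)"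
    if "x \<in> carrier M" "y \<in> carrier M" for x y
    using that by (simp add: Q_def quot_module_def N.a_rcos_sum)
  have smult: "a \<odot>\<^bsub>Q\<^esub> (N +>\<^bsub>M\<^esub> x) = N +>\<^bsub>M\<^esub> (a \<odot>\<^bsub>M\<^esub> x)"
    if "a \<in> carrier R" "x \<in> carrier M" for a x
    using smult[OF that] by (simp add: Q_def quot_module_def)
  have zero: "\<zero>\<^bsub>Q\<^esub> = N +>\<^bsub>M\<^esub> \<zero>\<^bsub>M\<^esub>"
    using N.a_subset by (simp add: Q_def quot_module_def M.a_coset_add_zero)
  have closed: "N +>\<^bsub>M\<^esub> x \<in> carrier Q" if "x \<in> carrier M" for x
    using that carrier by blast
  have "abelian_group Q"
  proof (rule abelian_groupI)
    show "\<exists>B\<in>carrier Q. B \<oplus>\<^bsub>Q\<^esub> A = \<zero>\<^bsub>Q\<^esub>" if "A \<in> carrier Q" for A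
    proof -
      obtain x where "x \<in> carrier M" "A = N +>\<^bsub>M\<^esub> x"
        using \<open>A \<in> carrier Q\<close> carrier by blast
      then show ?thesis
        using closed[of "\<ominus>\<^bsub>M\<^esub> x"] by (intro bexI) (simp_all add: add zero M.l_neg)
    qed
    show "A \<oplus>\<^bsub>Q\<^esub> B = B \<oplus>\<^bsub>Q\<^esub> A" if "A \<in> carrier Q" "B \<in> carrier Q" for A B
      using that unfolding carrier by (elim bexE) (simp add: add M.a_comm)
    show "A \<oplus>\<^bsub>Q\<^esub> B \<oplus>\<^bsub>Q\<^esub> C = A \<oplus>\<^bsub>Q\<^esub> (B \<oplus>\<^bsub>Q\<^esub> C)"
      if "A \<in> carrier Q" "B \<in> carrier Q" "C \<in> carrier Q" for A B C
      using that unfolding carrier by (elim bexE) (simp add: add M.a_assoc)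
    show "A \<oplus>\<^bsub>Q\<^esub> B \<in> carrier Q" if "A \<in> carrier Q" "B \<in> carrier Q" for A B
      using that unfolding carrier[of A] carrier[of B] by (elim bexE) (simp add: add closed)
    show "\<zero>\<^bsub>Q\<^esub> \<oplus>\<^bsub>Q\<^esub> A = A" if "A \<in> carrier Q" for A
      using that unfolding carrier zero by (elim bexE) (simp add: add del: M.a_coset_add_zero)
  qed (simp add: zero closed del: M.a_coset_add_zero)
  then have "module R Q"
  proof (intro moduleI R.is_cring)
    fix a A B
    assume a: "a \<in> carrier R" and A: "A \<in> carrier Q" and B: "B \<in> carrier Q"
    obtain x where x: "x \<in> carrier M" "A = N +>\<^bsub>M\<^esub> x"
      using A carrier by blast
    obtain y where y: "y \<in> carrier M" "B = N +>\<^bsub>M\<^esub> y"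
      using B carrier by blast
    show "a \<odot>\<^bsub>Q\<^esub> (A \<oplus>\<^bsub>Q\<^esub> B) = a \<odot>\<^bsub>Q\<^esub> A \<oplus>\<^bsub>Q\<^esub> a \<odot>\<^bsub>Q\<^esub> B"
      using a x y by (simp add: add smult smult_r_distr)
  next
    fix a b A
    assume a: "a \<in> carrier R" and b: "b \<in> carrier R" and A: "A \<in> carrier Q"
    obtain x where x: "x \<in> carrier M" "A = N +>\<^bsub>M\<^esub> x"
      using A carrier by blast
    show "(a \<oplus>\<^bsub>R\<^esub> b) \<odot>\<^bsub>Q\<^esub> A = a \<odot>\<^bsub>Q\<^esub> A \<oplus>\<^bsub>Q\<^esub> b \<odot>\<^bsub>Q\<^esub> A"
      and "(a \<otimes>\<^bsub>R\<^esub> b) \<odot>\<^bsub>Q\<^esub> A = a \<odot>\<^bsub>Q\<^esub> (b \<odot>\<^bsub>Q\<^esub> A)"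
      using a b x by (simp_all add: add smult smult_l_distr smult_assoc1)
  next
    fix a A
    assume a: "a \<in> carrier R" and A: "A \<in> carrier Q"
    obtain x where x: "x \<in> carrier M" "A = N +>\<^bsub>M\<^esub> x"
      using A carrier by blast
    show "a \<odot>\<^bsub>Q\<^esub> A \<in> carrier Q"
      using a x by (simp add: smult closed)
  next
    fix A
    assume A: "A \<in> carrier Q"
    obtain x where x: "x \<in> carrier M" "A = N +>\<^bsub>M\<^esub> x"
      using A carrier by blast
    show "\<one>\<^bsub>R\<^esub> \<odot>\<^bsub>Q\<^esub> A = A"
      using x by (simp add: smult)
  qed
  then show ?thesis
    by (simp add: Q_def)
qed

end

end

theory Submission
  imports Defs
begin

text \<open>Let \<open>L = M/N\<close>. The proof is an induction on the number \<open>d\<close> of generators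
  \<open>x\<^sub>1, \<dots>, x\<^sub>d\<close> of \<open>\<qq>\<close>.

  For \<open>d = 1\<close> and \<open>\<qq> = (x)\<close>, Nakayama's lemma gives \<open>\<mu>(N) \<le> \<ell>(N/xN)\<close>, so it suffices that
  \<open>\<ell>(N/xN) \<le> \<ell>(M/xM)\<close> (lemma \<open>chains_submodule_one_parameter\<close>). This holds because the Euler
  characteristic \<open>\<ell>(L/xL) - \<ell>(0 :\<^sub>L x)\<close> is non-negative. The proof compares \<open>N\<close> with its saturation
  \<open>H = {m. x\<^sup>k m \<in> N for some k}\<close>: since \<open>x\<close> is regular on \<open>M/H\<close>, the module \<open>H/xH\<close> embeds into \<open>M/xM\<close>;
  and \<open>H/N\<close> has finite length and maps onto \<open>xH/xN\<close>, so that computing \<open>\<ell>(H/xN)\<close> through \<open>N\<close> and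
  through \<open>xH\<close> yields \<open>\<ell>(N/xN) \<le> \<ell>(H/xH)\<close>.

  For \<open>d \<ge> 2\<close> the maximal ideal contains an element \<open>y\<close> that is regular on \<open>L\<close>. No associated prime
  \<open>P\<close> of \<open>L\<close> contains \<open>\<qq>\<close>: a power of \<open>y\<close> maps \<open>M\<close> into \<open>\<qq>M\<close>, and \<open>y \<notin> P\<close>, so \<open>\<qq> \<subseteq> P\<close> would make
  \<open>L\<close> vanish at \<open>P\<close> by Nakayama's lemma. Prime avoidance in the coset
  \<open>x\<^sub>1 + (x\<^sub>2, \<dots>, x\<^sub>d)\<close> gives an element \<open>z\<close> that is regular on \<open>L\<close> and satisfies
  \<open>\<qq> = (z, x\<^sub>2, \<dots>, x\<^sub>d)\<close>. Regularity means \<open>zM \<inter> N = zN\<close>, hence the image of \<open>N\<close> in \<open>M/zM\<close> is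
  \<open>N/zN\<close>, which needs as many generators as \<open>N\<close>. The induction hypothesis applies to \<open>M/zM\<close>,
  \<open>N/zN\<close> and \<open>(x\<^sub>2, \<dots>, x\<^sub>d)\<close>: the colength of the parameters is unchanged, and \<open>L/zL\<close> has depth at
  least \<open>d - 2\<close> (lemma \<open>depth_ge_exchange\<close>).

  The modules \<open>M/zM\<close>, \<open>L/zL\<close>, \<dots> are never formed. A quotient of \<open>M\<close> is represented by the
  submodule that is divided out, so that all the modules of the induction are intervals in the
  lattice of submodules of one fixed \<open>M\<close>: \<open>N \<subseteq> M\<close> becomes a pair \<open>A \<subseteq> K\<close> with \<open>K/A \<subseteq> M/A\<close>.\<close>

section \<open>Submodules\<close>

context module
begin

abbreviation gen :: "'c set \<Rightarrow> 'c set"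
  where "gen \<equiv> gen_submodule R M"

lemma submodule_zero: "submodule H R M \<Longrightarrow> \<zero>\<^bsub>M\<^esub> \<in> H"
  by (auto dest!: submodule.axioms(1) subgroup.one_closed)

lemma submodule_mem: "submodule H R M \<Longrightarrow> h \<in> H \<Longrightarrow> h \<in> carrier M"
  using submoduleE(1) by blast

lemmas submodule_add = submoduleE(5)
lemmas submodule_smult = submoduleE(4)

lemma submodule_diff: "submodule H R M \<Longrightarrow> a \<in> H \<Longrightarrow> b \<in> H \<Longrightarrow> a \<ominus>\<^bsub>M\<^esub> b \<in> H"
  by (simp add: a_minus_def submoduleE(3) submoduleE(5))

lemma add_diff_cancel: "a \<in> carrier M \<Longrightarrow> b \<in> carrier M \<Longrightarrow> (a \<oplus>\<^bsub>M\<^esub> b) \<ominus>\<^bsub>M\<^esub> b = a"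
  by (simp add: a_minus_def M.a_assoc M.r_neg)

lemma add_diff_cancel_left: "a \<in> carrier M \<Longrightarrow> b \<in> carrier M \<Longrightarrow> (a \<oplus>\<^bsub>M\<^esub> b) \<ominus>\<^bsub>M\<^esub> a = b"
  by (metis M.a_comm add_diff_cancel)

lemma diff_add_cancel: "a \<in> carrier M \<Longrightarrow> b \<in> carrier M \<Longrightarrow> (a \<ominus>\<^bsub>M\<^esub> b) \<oplus>\<^bsub>M\<^esub> b = a"
  by (simp add: a_minus_def M.a_assoc M.l_neg)

lemma diff_diff_cancel_left:
  assumes "p \<in> carrier M" "q \<in> carrier M" "r \<in> carrier M"
  shows "(p \<ominus>\<^bsub>M\<^esub> q) \<ominus>\<^bsub>M\<^esub> (p \<ominus>\<^bsub>M\<^esub> r) = r \<ominus>\<^bsub>M\<^esub> q"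
proof -
  have "(p \<ominus>\<^bsub>M\<^esub> q) \<ominus>\<^bsub>M\<^esub> (p \<ominus>\<^bsub>M\<^esub> r) = p \<oplus>\<^bsub>M\<^esub> (\<ominus>\<^bsub>M\<^esub> p \<oplus>\<^bsub>M\<^esub> (r \<oplus>\<^bsub>M\<^esub> \<ominus>\<^bsub>M\<^esub> q))"
    using assms by (simp add: a_minus_def M.minus_add M.a_ac)
  then show ?thesis
    using assms by (simp add: a_minus_def M.r_neg2)
qed

lemma submodule_add_cancel_left:
  assumes "submodule H R M" "a \<in> H" "b \<in> carrier M" "a \<oplus>\<^bsub>M\<^esub> b \<in> H"
  shows "b \<in> H"
  using submodule_diff[OF assms(1,4,2)] add_diff_cancel_left[of a b] assms submodule_mem by simp

lemma submodule_add_cancel_right: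
  assumes "submodule H R M" "b \<in> H" "a \<in> carrier M" "a \<oplus>\<^bsub>M\<^esub> b \<in> H"
  shows "a \<in> H"
  using submodule_diff[OF assms(1,4,2)] add_diff_cancel[of a b] assms submodule_mem by simp

lemma submodule_diff_cancel:
  assumes "submodule H R M" "b \<in> H" "a \<in> carrier M" "a \<ominus>\<^bsub>M\<^esub> b \<in> H"
  shows "a \<in> H"
  using submodule_add[OF assms(1,4,2)] diff_add_cancel[of a b] assms submodule_mem by simp

lemma submodule_Int:
  assumes "submodule H R M" "submodule K R M"
  shows "submodule (H \<inter> K) R M"
  using assms
  by (intro submoduleI) (auto intro: submoduleE submodule_zero dest: submodule_mem)

lemma smult_left_comm:
  "a \<in> carrier R \<Longrightarrow> b \<in> carrier R \<Longrightarrow> x \<in> carrier M \<Longrightarrow> a \<odot>\<^bsub>M\<^esub> (b \<odot>\<^bsub>M\<^esub> x) = b \<odot>\<^bsub>M\<^esub> (a \<odot>\<^bsub>M\<^esub> x)"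
  by (metis R.m_comm smult_assoc1)

lemma smult_l_diff:
  assumes "a \<in> carrier R" "b \<in> carrier R" "x \<in> carrier M"
  shows "(a \<ominus> b) \<odot>\<^bsub>M\<^esub> x = a \<odot>\<^bsub>M\<^esub> x \<ominus>\<^bsub>M\<^esub> b \<odot>\<^bsub>M\<^esub> x"
  using assms by (simp add: a_minus_def smult_l_distr smult_l_minus)

lemma smult_r_diff:
  assumes "a \<in> carrier R" "x \<in> carrier M" "y \<in> carrier M"
  shows "a \<odot>\<^bsub>M\<^esub> (x \<ominus>\<^bsub>M\<^esub> y) = a \<odot>\<^bsub>M\<^esub> x \<ominus>\<^bsub>M\<^esub> a \<odot>\<^bsub>M\<^esub> y"
  using assms by (simp add: a_minus_def smult_r_distr smult_r_minus)

lemma gen_superset: "S \<subseteq> gen S"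
  by (auto simp: gen_submodule_def)

lemma genI: "x \<in> S \<Longrightarrow> x \<in> gen S"
  using gen_superset by blast

lemma gen_least: "submodule H R M \<Longrightarrow> S \<subseteq> H \<Longrightarrow> gen S \<subseteq> H"
  by (auto simp: gen_submodule_def)

lemma gen_mono: "S \<subseteq> T \<Longrightarrow> gen S \<subseteq> gen T"
  by (auto simp: gen_submodule_def)

lemma gen_of_submodule: "submodule H R M \<Longrightarrow> gen H = H"
  using gen_least gen_superset by blast

lemma gen_closed: "S \<subseteq> carrier M \<Longrightarrow> gen S \<subseteq> carrier M"
  using gen_least carrier_is_submodule by blast

lemma plus_ideal_smult_submodule:
  assumes B: "submodule B R M" and I: "ideal I R" and u: "u \<in> carrier M"
  shows "submodule {b \<oplus>\<^bsub>M\<^esub> r \<odot>\<^bsub>M\<^esub> u | b r. b \<in> B \<and> r \<in> I} R M" (is "submodule ?T R M")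
proof (rule submoduleI)
  interpret I: ideal I R by (rule I)
  note Bc = submodule_mem[OF B]
  show "?T \<subseteq> carrier M"
    using Bc u I.Icarr by auto
  show "\<zero>\<^bsub>M\<^esub> \<in> ?T"
    using submodule_zero[OF B] u by (intro CollectI exI[of _ "\<zero>\<^bsub>M\<^esub>"] exI[of _ \<zero>]) auto
  fix x y assume x: "x \<in> ?T" and y: "y \<in> ?T"
  then obtain b r b' r' where x: "x = b \<oplus>\<^bsub>M\<^esub> r \<odot>\<^bsub>M\<^esub> u" "b \<in> B" "r \<in> I"
    and y: "y = b' \<oplus>\<^bsub>M\<^esub> r' \<odot>\<^bsub>M\<^esub> u" "b' \<in> B" "r' \<in> I"
    by blast
  have "x \<oplus>\<^bsub>M\<^esub> y = (b \<oplus>\<^bsub>M\<^esub> b') \<oplus>\<^bsub>M\<^esub> (r \<oplus> r') \<odot>\<^bsub>M\<^esub> u"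
    using x y u Bc I.Icarr by (simp add: smult_l_distr M.a_ac)
  then show "x \<oplus>\<^bsub>M\<^esub> y \<in> ?T"
    using x y submodule_add[OF B] I.a_closed by blast
  have "\<ominus>\<^bsub>M\<^esub> x = \<ominus>\<^bsub>M\<^esub> b \<oplus>\<^bsub>M\<^esub> (\<ominus> r) \<odot>\<^bsub>M\<^esub> u"
    using x u Bc I.Icarr by (simp add: smult_l_minus M.minus_add)
  then show "\<ominus>\<^bsub>M\<^esub> x \<in> ?T"
    using x submoduleE(3)[OF B] I.a_inv_closed by blast
  fix a assume a: "a \<in> carrier R"
  have "a \<odot>\<^bsub>M\<^esub> x = a \<odot>\<^bsub>M\<^esub> b \<oplus>\<^bsub>M\<^esub> (a \<otimes> r) \<odot>\<^bsub>M\<^esub> u"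
    using x u a Bc I.Icarr by (simp add: smult_assoc1 smult_r_distr)
  then show "a \<odot>\<^bsub>M\<^esub> x \<in> ?T"
    using x a submodule_smult[OF B] I.I_l_closed by blast
qed

lemma gen_insert:
  assumes B: "submodule B R M" and u: "u \<in> carrier M"
  shows "gen (insert u B) = {b \<oplus>\<^bsub>M\<^esub> r \<odot>\<^bsub>M\<^esub> u | b r. b \<in> B \<and> r \<in> carrier R}" (is "_ = ?T")
proof
  note Bc = submodule_mem[OF B]
  have "insert u B \<subseteq> ?T"
  proof
    fix x assume "x \<in> insert u B"
    then show "x \<in> ?T"
    proof
      assume "x = u"
      then show ?thesis
        using u submodule_zero[OF B]
        by (intro CollectI exI[of _ "\<zero>\<^bsub>M\<^esub>"] exI[of _ \<one>]) auto
    next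
      assume "x \<in> B"
      then show ?thesis
        using u Bc by (intro CollectI exI[of _ x] exI[of _ \<zero>]) auto
    qed
  qed
  then show "gen (insert u B) \<subseteq> ?T"
    by (rule gen_least[OF plus_ideal_smult_submodule[OF B R.oneideal u]])
  have G: "submodule (gen (insert u B)) R M"
    using u Bc by (intro gen_submodule_submodule) auto
  show "?T \<subseteq> gen (insert u B)"
    using gen_superset[of "insert u B"]
    by (auto intro!: submodule_add[OF G] submodule_smult[OF G])
qed

lemma gen_insertE:
  assumes "z \<in> gen (insert u B)" "submodule B R M" "u \<in> carrier M"
  obtains b r where "b \<in> B" "r \<in> carrier R" "z = b \<oplus>\<^bsub>M\<^esub> r \<odot>\<^bsub>M\<^esub> u"
  using assms(1) unfolding gen_insert[OF assms(2,3)] by blast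

lemma gen_insert_submodule:
  assumes "submodule B R M" "u \<in> carrier M"
  shows "submodule (gen (insert u B)) R M"
  using assms submodule_mem by (intro gen_submodule_submodule) auto

lemma gen_Un_gen:
  assumes "S \<subseteq> carrier M" "T \<subseteq> carrier M"
  shows "gen (gen S \<union> T) = gen (S \<union> T)"
proof
  have "submodule (gen (S \<union> T)) R M"
    using assms by (intro gen_submodule_submodule) auto
  then show "gen (gen S \<union> T) \<subseteq> gen (S \<union> T)"
    using gen_mono[of S "S \<union> T"] gen_superset[of "S \<union> T"] by (intro gen_least) auto
  show "gen (S \<union> T) \<subseteq> gen (gen S \<union> T)"
    using gen_superset[of S] by (intro gen_mono) auto
qed

lemma gen_insert_gen:
  assumes "S \<subseteq> carrier M" "u \<in> carrier M"
  shows "gen (insert u (gen S)) = gen (insert u S)"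
  using gen_Un_gen[of S "{u}"] assms by simp


definition plus_mult :: "'c set \<Rightarrow> 'a \<Rightarrow> 'c set \<Rightarrow> 'c set"
  where "plus_mult K r H = {k \<oplus>\<^bsub>M\<^esub> r \<odot>\<^bsub>M\<^esub> h | k h. k \<in> K \<and> h \<in> H}"

lemma plus_multI: "k \<in> K \<Longrightarrow> h \<in> H \<Longrightarrow> k \<oplus>\<^bsub>M\<^esub> r \<odot>\<^bsub>M\<^esub> h \<in> plus_mult K r H"
  by (auto simp: plus_mult_def)

lemma plus_multE:
  assumes "z \<in> plus_mult K r H"
  obtains k h where "k \<in> K" "h \<in> H" "z = k \<oplus>\<^bsub>M\<^esub> r \<odot>\<^bsub>M\<^esub> h"
  using assms by (auto simp: plus_mult_def)

lemma plus_mult_submodule: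
  assumes K: "submodule K R M" and H: "submodule H R M" and r: "r \<in> carrier R"
  shows "submodule (plus_mult K r H) R M"
proof (rule submoduleI)
  note Kc = submodule_mem[OF K] and Hc = submodule_mem[OF H]
  show "plus_mult K r H \<subseteq> carrier M"
    using Kc Hc r by (auto elim!: plus_multE)
  show "\<zero>\<^bsub>M\<^esub> \<in> plus_mult K r H"
    using plus_multI[OF submodule_zero[OF K] submodule_zero[OF H], of r] r by simp
  fix x y assume x: "x \<in> plus_mult K r H" and y: "y \<in> plus_mult K r H"
  obtain k h where x: "x = k \<oplus>\<^bsub>M\<^esub> r \<odot>\<^bsub>M\<^esub> h" "k \<in> K" "h \<in> H"
    using x by (rule plus_multE)
  obtain k' h' where y: "y = k' \<oplus>\<^bsub>M\<^esub> r \<odot>\<^bsub>M\<^esub> h'" "k' \<in> K" "h' \<in> H"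
    using y by (rule plus_multE)
  have "x \<oplus>\<^bsub>M\<^esub> y = (k \<oplus>\<^bsub>M\<^esub> k') \<oplus>\<^bsub>M\<^esub> r \<odot>\<^bsub>M\<^esub> (h \<oplus>\<^bsub>M\<^esub> h')"
    using x y r Kc Hc by (simp add: smult_r_distr M.a_ac)
  then show "x \<oplus>\<^bsub>M\<^esub> y \<in> plus_mult K r H"
    using x y submodule_add[OF K] submodule_add[OF H] by (simp add: plus_multI)
  have "\<ominus>\<^bsub>M\<^esub> x = \<ominus>\<^bsub>M\<^esub> k \<oplus>\<^bsub>M\<^esub> r \<odot>\<^bsub>M\<^esub> (\<ominus>\<^bsub>M\<^esub> h)"
    using x r Kc Hc by (simp add: smult_r_minus M.minus_add)
  then show "\<ominus>\<^bsub>M\<^esub> x \<in> plus_mult K r H"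
    using x submoduleE(3)[OF K] submoduleE(3)[OF H] by (simp add: plus_multI)
  fix a assume a: "a \<in> carrier R"
  have "a \<odot>\<^bsub>M\<^esub> x = a \<odot>\<^bsub>M\<^esub> k \<oplus>\<^bsub>M\<^esub> r \<odot>\<^bsub>M\<^esub> (a \<odot>\<^bsub>M\<^esub> h)"
    using x a r Kc Hc by (simp add: smult_r_distr smult_left_comm)
  then show "a \<odot>\<^bsub>M\<^esub> x \<in> plus_mult K r H"
    using x a submodule_smult[OF K] submodule_smult[OF H] by (simp add: plus_multI)
qed

lemma plus_mult_superset:
  assumes "submodule K R M" "submodule H R M" "r \<in> carrier R"
  shows "K \<subseteq> plus_mult K r H"
proof
  fix k assume k: "k \<in> K"
  then show "k \<in> plus_mult K r H"
    using plus_multI[OF k submodule_zero[OF assms(2)], of r] assms submodule_mem by simp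
qed

lemma plus_mult_smult:
  assumes "submodule K R M" "submodule H R M" "r \<in> carrier R" "h \<in> H"
  shows "r \<odot>\<^bsub>M\<^esub> h \<in> plus_mult K r H"
  using plus_multI[OF submodule_zero[OF assms(1)] assms(4), of r] assms submodule_mem by simp

lemma plus_mult_least:
  assumes U: "submodule U R M" and "K \<subseteq> U" "\<And>h. h \<in> H \<Longrightarrow> r \<odot>\<^bsub>M\<^esub> h \<in> U"
  shows "plus_mult K r H \<subseteq> U"
  using assms by (auto elim!: plus_multE intro!: submodule_add[OF U])

text \<open>The submodule \<open>K + X M\<close>. Dividing \<open>M/K\<close> by the elements of \<open>X\<close> means passing from \<open>K\<close> to
  \<open>plus_times K X\<close>.\<close>

definition plus_times :: "'c set \<Rightarrow> 'a set \<Rightarrow> 'c set"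
  where "plus_times K X = gen (K \<union> {a \<odot>\<^bsub>M\<^esub> m | a m. a \<in> X \<and> m \<in> carrier M})"

lemma plus_times_submodule:
  assumes "submodule K R M" "X \<subseteq> carrier R"
  shows "submodule (plus_times K X) R M"
  unfolding plus_times_def using assms submodule_mem by (intro gen_submodule_submodule) auto

lemma plus_times_superset: "K \<subseteq> plus_times K X"
  unfolding plus_times_def using gen_superset by blast

lemma plus_times_smult: "a \<in> X \<Longrightarrow> m \<in> carrier M \<Longrightarrow> a \<odot>\<^bsub>M\<^esub> m \<in> plus_times K X"
  unfolding plus_times_def by (rule subsetD[OF gen_superset]) auto

lemma plus_times_least:
  assumes "submodule U R M" "K \<subseteq> U" "\<And>a m. a \<in> X \<Longrightarrow> m \<in> carrier M \<Longrightarrow> a \<odot>\<^bsub>M\<^esub> m \<in> U"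
  shows "plus_times K X \<subseteq> U"
  unfolding plus_times_def using assms by (intro gen_least) auto

lemma plus_times_singleton:
  assumes "submodule K R M" "y \<in> carrier R"
  shows "plus_times K {y} = plus_mult K y (carrier M)"
proof
  note C = carrier_is_submodule
  show "plus_times K {y} \<subseteq> plus_mult K y (carrier M)"
    using plus_mult_submodule[OF assms(1) C assms(2)] plus_mult_superset[OF assms(1) C assms(2)]
      plus_mult_smult[OF assms(1) C assms(2)]
    by (intro plus_times_least) auto
  show "plus_mult K y (carrier M) \<subseteq> plus_times K {y}"
    using plus_times_submodule[OF assms(1), of "{y}"] assms(2)
    by (intro plus_mult_least) (auto intro: plus_times_smult subsetD[OF plus_times_superset])
qed

lemma plus_times_singletonE:
  assumes "z \<in> plus_times K {y}" "submodule K R M" "y \<in> carrier R"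
  obtains k m where "k \<in> K" "m \<in> carrier M" "z = k \<oplus>\<^bsub>M\<^esub> y \<odot>\<^bsub>M\<^esub> m"
  using assms(1) plus_multE unfolding plus_times_singleton[OF assms(2,3)] by blast

lemma plus_times_plus_times:
  assumes K: "submodule K R M" and X: "X \<subseteq> carrier R" and Y: "Y \<subseteq> carrier R"
  shows "plus_times (plus_times K X) Y = plus_times K (X \<union> Y)"
proof
  have XY: "submodule (plus_times K (X \<union> Y)) R M"
    using plus_times_submodule[OF K, of "X \<union> Y"] X Y by blast
  have "plus_times K X \<subseteq> plus_times K (X \<union> Y)"
    by (rule plus_times_least[OF XY plus_times_superset]) (simp add: plus_times_smult)
  then show "plus_times (plus_times K X) Y \<subseteq> plus_times K (X \<union> Y)"
    by (rule plus_times_least[OF XY]) (simp add: plus_times_smult)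
  show "plus_times K (X \<union> Y) \<subseteq> plus_times (plus_times K X) Y"
  proof (rule plus_times_least[OF plus_times_submodule[OF plus_times_submodule[OF K X] Y]])
    show "K \<subseteq> plus_times (plus_times K X) Y"
      by (rule subset_trans[OF plus_times_superset plus_times_superset])
  qed (auto intro: plus_times_smult subsetD[OF plus_times_superset])
qed

lemma smult_multipliers_ideal:
  assumes U: "submodule U R M"
  shows "ideal {a \<in> carrier R. \<forall>m\<in>carrier M. a \<odot>\<^bsub>M\<^esub> m \<in> U} R"
proof (rule idealI[OF R.ring_axioms])
  show "subgroup {a \<in> carrier R. \<forall>m\<in>carrier M. a \<odot>\<^bsub>M\<^esub> m \<in> U} (add_monoid R)"
  proof (rule R.add.subgroupI)
    show "{a \<in> carrier R. \<forall>m\<in>carrier M. a \<odot>\<^bsub>M\<^esub> m \<in> U} \<noteq> {}"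
      using R.zero_closed submodule_zero[OF U] by force
  qed (auto simp: smult_l_minus smult_l_distr submoduleE[OF U] simp flip: a_inv_def)
qed (auto simp: smult_assoc1 submodule_smult[OF U])

lemma plus_times_Idl:
  assumes K: "submodule K R M" and X: "X \<subseteq> carrier R"
  shows "plus_times K (Idl\<^bsub>R\<^esub> X) = plus_times K X"
proof
  have "Idl\<^bsub>R\<^esub> X \<subseteq> {a \<in> carrier R. \<forall>m\<in>carrier M. a \<odot>\<^bsub>M\<^esub> m \<in> plus_times K X}"
    using X by (intro R.genideal_minimal smult_multipliers_ideal plus_times_submodule K)
      (auto intro: plus_times_smult)
  then show "plus_times K (Idl\<^bsub>R\<^esub> X) \<subseteq> plus_times K X"
    by (intro plus_times_least plus_times_submodule K X plus_times_superset) auto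
  show "plus_times K X \<subseteq> plus_times K (Idl\<^bsub>R\<^esub> X)"
    using R.genideal_self[OF X] R.genideal_ideal[OF X] K ideal.Icarr
    by (intro plus_times_least plus_times_submodule plus_times_superset)
      (auto intro: plus_times_smult)
qed

lemma ideal_times_eq_plus_times: "ideal_times R I M = plus_times {\<zero>\<^bsub>M\<^esub>} I" if "I \<subseteq> carrier R"
proof -
  have "submodule {\<zero>\<^bsub>M\<^esub>} R M"
    by (rule submoduleI) auto
  then show ?thesis
    using ideal_times_submodule[OF that] plus_times_submodule[OF _ that]
    unfolding ideal_times_def
    by (intro equalityI gen_least plus_times_least)
      (auto intro: plus_times_smult submodule_zero subsetD[OF gen_superset])
qed

definition elem_colon :: "'c set \<Rightarrow> 'c \<Rightarrow> 'a set"
  where "elem_colon K u = {r \<in> carrier R. r \<odot>\<^bsub>M\<^esub> u \<in> K}"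

lemma elem_colon_ideal:
  assumes K: "submodule K R M" and u: "u \<in> carrier M"
  shows "ideal (elem_colon K u) R"
  unfolding elem_colon_def
proof (rule idealI[OF R.ring_axioms])
  show "subgroup {r \<in> carrier R. r \<odot>\<^bsub>M\<^esub> u \<in> K} (add_monoid R)"
  proof (rule R.add.subgroupI)
    show "{r \<in> carrier R. r \<odot>\<^bsub>M\<^esub> u \<in> K} \<noteq> {}"
      using R.zero_closed submodule_zero[OF K] u by force
  qed (auto simp: u smult_l_minus smult_l_distr submoduleE[OF K] simp flip: a_inv_def)
next
  fix a x assume a: "a \<in> {r \<in> carrier R. r \<odot>\<^bsub>M\<^esub> u \<in> K}" and x: "x \<in> carrier R"
  show "x \<otimes> a \<in> {r \<in> carrier R. r \<odot>\<^bsub>M\<^esub> u \<in> K}"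
    using a x u submodule_smult[OF K] by (simp add: smult_assoc1)
  then show "a \<otimes> x \<in> {r \<in> carrier R. r \<odot>\<^bsub>M\<^esub> u \<in> K}"
    using a x by (simp add: R.m_comm)
qed

definition scalar_colon :: "'c set \<Rightarrow> 'a \<Rightarrow> 'c set"
  where "scalar_colon K r = {m \<in> carrier M. r \<odot>\<^bsub>M\<^esub> m \<in> K}"

lemma scalar_colon_submodule:
  assumes K: "submodule K R M" and r: "r \<in> carrier R"
  shows "submodule (scalar_colon K r) R M"
  using r submodule_zero[OF K]
  by (intro submoduleI)
    (auto simp: scalar_colon_def smult_r_minus smult_r_distr smult_left_comm[of r] submoduleE[OF K])

end

section \<open>Noetherian modules\<close>

locale fg_noetherian_module = module R M + noetherian_ring R
  for R (structure) and M (structure) +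
  assumes fg: "finitely_generated R M"
begin

text \<open>Hilbert's argument, by induction on the number of generators: modulo the span \<open>B\<close> of the other
  generators, an element of \<open>H\<close> is determined by its coefficient at \<open>g\<close>. The coefficients that
  occur form an ideal, generated by the coefficients of finitely many elements of \<open>H\<close>; these
  elements and generators of \<open>H \<inter> B\<close> generate \<open>H\<close>.\<close>

lemma fg_submodule_of_gen:
  assumes "finite G" "G \<subseteq> carrier M" "submodule H R M" "H \<subseteq> gen G"
  shows "\<exists>S\<subseteq>H. finite S \<and> H = gen S"
  using assms
proof (induction G arbitrary: H)
  case empty
  then show ?case
    using gen_least[of H "{}"] by (intro exI[of _ "{}"]) auto
next
  case (insert g G)
  define B where "B = gen G"
  have g: "g \<in> carrier M" and B: "submodule B R M"
    using insert.prems gen_submodule_submodule unfolding B_def by auto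
  note H = insert.prems(2)
  note Bc = submodule_mem[OF B] and Hc = submodule_mem[OF H]
  \<comment> \<open>The coefficients at \<open>g\<close> of elements of \<open>T\<close>: \<open>r\<close> with \<open>r g \<in> B + T\<close>.\<close>
  define coef where "coef T = elem_colon (plus_mult B \<one> T) g" for T
  have coef_ideal: "ideal (coef T) R" if "submodule T R M" for T
    unfolding coef_def using that B g by (intro elem_colon_ideal plus_mult_submodule) auto
  obtain A where A: "A \<subseteq> carrier R" "finite A" "coef H = Idl A"
    using finetely_gen[OF coef_ideal[OF H]] by blast
  have "\<exists>h\<in>H. \<exists>b\<in>B. a \<odot>\<^bsub>M\<^esub> g = b \<oplus>\<^bsub>M\<^esub> h" if "a \<in> A" for a
  proof -
    have "a \<odot>\<^bsub>M\<^esub> g \<in> plus_mult B \<one> H"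
      using that A R.genideal_self by (auto simp: coef_def elem_colon_def)
    then show ?thesis
      by (rule plus_multE) (use Hc in auto)
  qed
  then obtain f where f: "\<And>a. a \<in> A \<Longrightarrow> f a \<in> H" "\<And>a. a \<in> A \<Longrightarrow> \<exists>b\<in>B. a \<odot>\<^bsub>M\<^esub> g = b \<oplus>\<^bsub>M\<^esub> f a"
    by metis
  obtain S' where S': "S' \<subseteq> H \<inter> B" "finite S'" "H \<inter> B = gen S'"
    using insert.IH[of "H \<inter> B"] insert.prems submodule_Int[OF H B] unfolding B_def by blast
  define T where "T = gen (f ` A \<union> S')"
  have SH: "f ` A \<union> S' \<subseteq> H"
    using f S' by blast
  have T: "submodule T R M"
    unfolding T_def using SH Hc by (intro gen_submodule_submodule) auto
  note Tc = submodule_mem[OF T]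
  have "T \<subseteq> H"
    unfolding T_def by (rule gen_least[OF H SH])
  have fT: "f a \<in> T" if "a \<in> A" for a
    using that unfolding T_def by (intro genI) simp
  have "A \<subseteq> coef T"
  proof
    fix a assume a: "a \<in> A"
    then obtain b where b: "b \<in> B" "a \<odot>\<^bsub>M\<^esub> g = b \<oplus>\<^bsub>M\<^esub> f a"
      using f by blast
    then have "a \<odot>\<^bsub>M\<^esub> g \<in> plus_mult B \<one> T"
      using plus_multI[OF b(1) fT[OF a], of \<one>] Tc[OF fT[OF a]] by simp
    then show "a \<in> coef T"
      using a A by (auto simp: coef_def elem_colon_def)
  qed
  then have coef_le: "coef H \<subseteq> coef T"
    unfolding A(3) by (rule R.genideal_minimal[OF coef_ideal[OF T]])
  have HBT: "H \<inter> B \<subseteq> T"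
    unfolding S'(3) T_def by (rule gen_mono) blast
  have "H \<subseteq> T"
  proof
    fix h assume h: "h \<in> H"
    have "h \<in> gen (insert g B)"
      using h insert.prems gen_insert_gen[of G g] unfolding B_def by auto
    then obtain b r where br: "b \<in> B" "r \<in> carrier R" "h = b \<oplus>\<^bsub>M\<^esub> r \<odot>\<^bsub>M\<^esub> g"
      using B g by (rule gen_insertE)
    have rg: "r \<odot>\<^bsub>M\<^esub> g \<in> carrier M"
      using br g by simp
    have "r \<odot>\<^bsub>M\<^esub> g = \<ominus>\<^bsub>M\<^esub> b \<oplus>\<^bsub>M\<^esub> \<one> \<odot>\<^bsub>M\<^esub> h"
      using br g Bc by (simp add: M.a_assoc[symmetric] M.l_neg)
    then have "r \<in> coef H"
      using plus_multI[OF submoduleE(3)[OF B br(1)] h, of \<one>] br(2)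
      by (simp add: coef_def elem_colon_def)
    then have "r \<odot>\<^bsub>M\<^esub> g \<in> plus_mult B \<one> T"
      using coef_le by (auto simp: coef_def elem_colon_def)
    then obtain b' t where t: "b' \<in> B" "t \<in> T" "r \<odot>\<^bsub>M\<^esub> g = b' \<oplus>\<^bsub>M\<^esub> t"
      by (rule plus_multE) (use Tc in auto)
    have h_eq: "h = (b \<oplus>\<^bsub>M\<^esub> b') \<oplus>\<^bsub>M\<^esub> t"
      using br(3) t Bc[OF br(1)] Bc[OF t(1)] Tc[OF t(2)] by (simp add: M.a_assoc)
    have bb: "b \<oplus>\<^bsub>M\<^esub> b' \<in> B"
      using submodule_add[OF B] br t by blast
    have "b \<oplus>\<^bsub>M\<^esub> b' \<in> H"
      using submodule_add_cancel_right[OF H, of t "b \<oplus>\<^bsub>M\<^esub> b'"] h h_eq t \<open>T \<subseteq> H\<close> Bc[OF bb] by auto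
    then show "h \<in> T"
      using bb HBT h_eq submodule_add[OF T] t by blast
  qed
  with \<open>T \<subseteq> H\<close> have "H = T" by blast
  then show ?case
    using SH A S' unfolding T_def by blast
qed

lemma submodule_fg:
  assumes "submodule H R M"
  obtains S where "S \<subseteq> H" "finite S" "H = gen S"
proof -
  obtain G where "G \<subseteq> carrier M" "finite G" "gen G = carrier M"
    using fg unfolding finitely_generated_def by blast
  then show ?thesis
    using fg_submodule_of_gen[of G H] assms submodule_mem that by blast
qed

text \<open>A generating set of the union of a chain is finite, so it lies in one member of the chain.\<close>

lemma submodule_maximal_exists:
  assumes ne: "F \<noteq> {}" and sub: "\<And>H. H \<in> F \<Longrightarrow> submodule H R M"
  shows "\<exists>H\<in>F. \<forall>X\<in>F. H \<subseteq> X \<longrightarrow> X = H"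
proof (rule subset_Zorn_nonempty[OF ne])
  fix C assume C: "C \<noteq> {}" "subset.chain F C"
  then have CF: "\<And>X. X \<in> C \<Longrightarrow> submodule X R M"
    using sub by (auto simp: subset_chain_def)
  have two: "\<exists>Z\<in>C. X \<subseteq> Z \<and> Y \<subseteq> Z" if "X \<in> C" "Y \<in> C" for X Y
  proof -
    have "X \<subseteq> Y \<or> Y \<subseteq> X"
      using that C(2) by (simp add: subset_chain_def)
    then show ?thesis
      using that by blast
  qed
  have "submodule (\<Union>C) R M"
  proof (rule submoduleI)
    show "\<Union>C \<subseteq> carrier M"
      using CF submodule_mem by blast
    show "\<zero>\<^bsub>M\<^esub> \<in> \<Union>C"
      using CF C submodule_zero by blast
    show "\<ominus>\<^bsub>M\<^esub> a \<in> \<Union>C" if "a \<in> \<Union>C" for a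
      using that CF submoduleE(3) by blast
    show "a \<oplus>\<^bsub>M\<^esub> b \<in> \<Union>C" if a: "a \<in> \<Union>C" and b: "b \<in> \<Union>C" for a b
    proof -
      obtain Z where "Z \<in> C" "a \<in> Z" "b \<in> Z"
        using a b two by blast
      then show ?thesis
        using submodule_add[OF CF] by blast
    qed
    show "a \<odot>\<^bsub>M\<^esub> x \<in> \<Union>C" if "a \<in> carrier R" "x \<in> \<Union>C" for a x
      using that CF submodule_smult by blast
  qed
  then obtain S where S: "S \<subseteq> \<Union>C" "finite S" "\<Union>C = gen S"
    by (rule submodule_fg)
  obtain X where X: "X \<in> C" "S \<subseteq> X"
    using finite_subset_Union_chain[OF S(2,1) C] by blast
  have "\<Union>C \<subseteq> X"
    unfolding S(3) by (rule gen_least[OF CF[OF X(1)] X(2)])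
  then have "\<Union>C = X"
    using X by blast
  then show "\<Union>C \<in> F"
    using X C by (auto simp: subset_chain_def)
qed

lemma ideal_maximal_exists:
  assumes "F \<noteq> {}" and sub: "\<And>I. I \<in> F \<Longrightarrow> ideal I R"
  shows "\<exists>I\<in>F. \<forall>J\<in>F. I \<subseteq> J \<longrightarrow> J = I"
proof (rule subset_Zorn_nonempty[OF assms(1)])
  fix C assume C: "C \<noteq> {}" "subset.chain F C"
  then have "subset.chain {I. ideal I R} C"
    using sub by (auto simp: subset_chain_def)
  then show "\<Union>C \<in> F"
    using ideal_chain_is_trivial[OF C(1)] C by (auto simp: subset_chain_def)
qed

section \<open>Associated primes\<close>

definition assoc_primes :: "'c set \<Rightarrow> 'a set set"
  where "assoc_primes K = {P. primeideal P R \<and> (\<exists>u\<in>carrier M. P = elem_colon K u)}"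

lemma elem_colon_smult_mono:
  assumes "submodule K R M" "u \<in> carrier M" "s \<in> carrier R"
  shows "elem_colon K u \<subseteq> elem_colon K (s \<odot>\<^bsub>M\<^esub> u)"
  using assms by (auto simp: elem_colon_def smult_left_comm[of _ s] submodule_smult)

lemma elem_colon_proper:
  assumes "u \<in> carrier M" "u \<notin> K"
  shows "\<one> \<notin> elem_colon K u"
  using assms by (auto simp: elem_colon_def)

text \<open>A maximal element among the annihilators of non-zero elements of \<open>M/K\<close> is prime.\<close>

lemma assoc_prime_above:
  assumes K: "submodule K R M" and u: "u \<in> carrier M" "u \<notin> K"
  obtains P where "P \<in> assoc_primes K" "elem_colon K u \<subseteq> P"
proof -
  define F where "F = {elem_colon K v | v. v \<in> carrier M \<and> v \<notin> K \<and> elem_colon K u \<subseteq> elem_colon K v}"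
  have "F \<noteq> {}"
    using u by (auto simp: F_def)
  moreover have "ideal J R" if "J \<in> F" for J
    using that elem_colon_ideal[OF K] by (auto simp: F_def)
  ultimately have "\<exists>P\<in>F. \<forall>J\<in>F. P \<subseteq> J \<longrightarrow> J = P"
    by (rule ideal_maximal_exists)
  then obtain P where P: "P \<in> F" "\<forall>J\<in>F. P \<subseteq> J \<longrightarrow> J = P" ..
  then obtain v where v: "v \<in> carrier M" "v \<notin> K" "P = elem_colon K v" "elem_colon K u \<subseteq> P"
    by (auto simp: F_def)
  have "primeideal P R"
  proof (rule primeidealI)
    show "ideal P R"
      using v elem_colon_ideal[OF K] by simp
    show "cring R"
      by (rule R.is_cring)
    show "carrier R \<noteq> P"
      using elem_colon_proper[OF v(1,2)] v(3) by auto
    fix a b assume ab: "a \<in> carrier R" "b \<in> carrier R" "a \<otimes> b \<in> P"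
    show "a \<in> P \<or> b \<in> P"
    proof (rule disjCI)
      assume b: "b \<notin> P"
      have "elem_colon K (b \<odot>\<^bsub>M\<^esub> v) \<in> F"
        using b ab v elem_colon_smult_mono[OF K v(1) ab(2)]
        by (auto simp: F_def elem_colon_def)
      then have "elem_colon K (b \<odot>\<^bsub>M\<^esub> v) = P"
        using P(2) elem_colon_smult_mono[OF K v(1) ab(2)] v(3) by blast
      moreover have "a \<in> elem_colon K (b \<odot>\<^bsub>M\<^esub> v)"
        using ab v by (simp add: elem_colon_def smult_assoc1)
      ultimately show "a \<in> P" by blast
    qed
  qed
  then show ?thesis
    using that v by (auto simp: assoc_primes_def)
qed

text \<open>If \<open>R v\<close> meets \<open>R u\<close> non-trivially modulo \<open>K\<close>, then the intersection sits in both domains \<open>R/P\<close>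
  and \<open>R/Q\<close>, and so has annihilator \<open>P = Q\<close>; otherwise \<open>v\<close> keeps its annihilator modulo \<open>K + R u\<close>.\<close>

lemma assoc_primes_insert:
  assumes K: "submodule K R M" and u: "u \<in> carrier M" and Q: "primeideal (elem_colon K u) R"
  shows "assoc_primes K \<subseteq> insert (elem_colon K u) (assoc_primes (gen (insert u K)))"
proof
  note Q_prime = primeideal.I_prime[OF Q] and Q_closed = ideal.I_r_closed[OF primeideal.axioms(1)[OF Q]]
  fix P assume "P \<in> assoc_primes K"
  then obtain v where P: "primeideal P R" and v: "v \<in> carrier M" "P = elem_colon K v"
    by (auto simp: assoc_primes_def)
  note P_prime = primeideal.I_prime[OF P] and P_closed = ideal.I_r_closed[OF primeideal.axioms(1)[OF P]]
  show "P \<in> insert (elem_colon K u) (assoc_primes (gen (insert u K)))"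
  proof (cases "elem_colon (gen (insert u K)) v \<subseteq> P")
    case True
    moreover have "P \<subseteq> elem_colon (gen (insert u K)) v"
    proof
      fix t assume "t \<in> P"
      then have "t \<in> elem_colon K v"
        using v(2) by blast
      then have t: "t \<in> carrier R" "t \<odot>\<^bsub>M\<^esub> v \<in> K"
        unfolding elem_colon_def by blast+
      have "t \<odot>\<^bsub>M\<^esub> v \<in> gen (insert u K)"
        using t(2) by (intro genI insertI2)
      then show "t \<in> elem_colon (gen (insert u K)) v"
        using t(1) unfolding elem_colon_def by blast
    qed
    ultimately have "P = elem_colon (gen (insert u K)) v" by blast
    then show ?thesis
      using P v by (auto simp: assoc_primes_def)
  next
    case False
    then obtain s where s: "s \<in> carrier R" "s \<odot>\<^bsub>M\<^esub> v \<in> gen (insert u K)" "s \<notin> P"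
      by (auto simp: elem_colon_def)
    obtain k r where kr: "k \<in> K" "r \<in> carrier R" "s \<odot>\<^bsub>M\<^esub> v = k \<oplus>\<^bsub>M\<^esub> r \<odot>\<^bsub>M\<^esub> u"
      using s(2) K u by (rule gen_insertE)
    have rQ: "r \<notin> elem_colon K u"
    proof
      assume "r \<in> elem_colon K u"
      then have "s \<odot>\<^bsub>M\<^esub> v \<in> K"
        using kr submodule_add[OF K] by (auto simp: elem_colon_def)
      then show False
        using s v by (auto simp: elem_colon_def)
    qed
    have "t \<in> P \<longleftrightarrow> t \<in> elem_colon K u" if t: "t \<in> carrier R" for t
    proof -
      have "t \<in> P \<longleftrightarrow> t \<otimes> s \<in> P"
        using P_prime[OF t s(1)] P_closed s t by blast
      also have "\<dots> \<longleftrightarrow> t \<odot>\<^bsub>M\<^esub> (s \<odot>\<^bsub>M\<^esub> v) \<in> K"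
        using t s v by (simp add: elem_colon_def smult_assoc1)
      also have "t \<odot>\<^bsub>M\<^esub> (s \<odot>\<^bsub>M\<^esub> v) = t \<odot>\<^bsub>M\<^esub> k \<oplus>\<^bsub>M\<^esub> (t \<otimes> r) \<odot>\<^bsub>M\<^esub> u"
        using kr t u submodule_mem[OF K] by (simp add: smult_r_distr smult_assoc1)
      also have "\<dots> \<in> K \<longleftrightarrow> (t \<otimes> r) \<odot>\<^bsub>M\<^esub> u \<in> K"
        using submodule_add_cancel_left[OF K submodule_smult[OF K t kr(1)]]
          submodule_add[OF K submodule_smult[OF K t kr(1)]] t kr u by auto
      also have "\<dots> \<longleftrightarrow> t \<otimes> r \<in> elem_colon K u"
        using t kr by (simp add: elem_colon_def)
      also have "\<dots> \<longleftrightarrow> t \<in> elem_colon K u"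
        using Q_prime[OF t kr(2)] Q_closed kr(2) rQ t by blast
      finally show ?thesis .
    qed
    then have "P = elem_colon K u"
      using v(2) unfolding elem_colon_def by blast
    then show ?thesis by simp
  qed
qed

text \<open>A largest submodule \<open>K\<close> with infinitely many associated primes cannot exist: adding to \<open>K\<close> an
  element whose annihilator modulo \<open>K\<close> is prime loses at most one of them.\<close>

lemma finite_assoc_primes:
  assumes "submodule K R M"
  shows "finite (assoc_primes K)"
proof (rule ccontr)
  assume "infinite (assoc_primes K)"
  define F where "F = {K. submodule K R M \<and> infinite (assoc_primes K)}"
  have "F \<noteq> {}"
    using assms \<open>infinite (assoc_primes K)\<close> by (auto simp: F_def)
  moreover have "submodule X R M" if "X \<in> F" for X
    using that by (simp add: F_def)
  ultimately have "\<exists>K\<in>F. \<forall>X\<in>F. K \<subseteq> X \<longrightarrow> X = K"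
    by (rule submodule_maximal_exists)
  then obtain K where "K \<in> F" and maximal: "\<forall>X\<in>F. K \<subseteq> X \<longrightarrow> X = K" ..
  then have K: "submodule K R M" "infinite (assoc_primes K)"
    by (simp_all add: F_def)
  have max: "finite (assoc_primes X)" if "submodule X R M" "K \<subset> X" for X
  proof (rule ccontr)
    assume "infinite (assoc_primes X)"
    then have "X \<in> F"
      using that(1) by (simp add: F_def)
    then show False
      using maximal that(2) by blast
  qed
  have "assoc_primes (carrier M) = {}"
  proof -
    have "elem_colon (carrier M) u = carrier R" if "u \<in> carrier M" for u
      using that by (auto simp: elem_colon_def)
    then show ?thesis
      using primeideal.I_notcarr by (auto simp: assoc_primes_def)
  qed
  then have "K \<noteq> carrier M"
    using K(2) by auto
  then obtain v where "v \<in> carrier M" "v \<notin> K"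
    using submodule_mem[OF K(1)] by blast
  then obtain Q where "Q \<in> assoc_primes K"
    by (rule assoc_prime_above[OF K(1)])
  then obtain u where u: "u \<in> carrier M" and Q: "primeideal (elem_colon K u) R"
    by (auto simp: assoc_primes_def)
  have "u \<notin> K"
  proof
    assume "u \<in> K"
    then have "elem_colon K u = carrier R"
      using submodule_smult[OF K(1)] by (auto simp: elem_colon_def)
    then show False
      using primeideal.I_notcarr[OF Q] by simp
  qed
  then have "K \<subset> gen (insert u K)"
    using gen_superset[of "insert u K"] by blast
  then have "finite (assoc_primes (gen (insert u K)))"
    using max gen_insert_submodule[OF K(1) u] by blast
  then show False
    using assoc_primes_insert[OF K(1) u Q] K(2) by (meson finite_insert finite_subset)
qed

definition regular_mod :: "'c set \<Rightarrow> 'a \<Rightarrow> bool"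
  where "regular_mod K r \<longleftrightarrow> (\<forall>m\<in>carrier M. r \<odot>\<^bsub>M\<^esub> m \<in> K \<longrightarrow> m \<in> K)"

lemma regular_mod_if_avoids_assoc_primes:
  assumes K: "submodule K R M" and r: "r \<in> carrier R" and av: "\<And>P. P \<in> assoc_primes K \<Longrightarrow> r \<notin> P"
  shows "regular_mod K r"
  unfolding regular_mod_def
proof (intro ballI impI, rule ccontr)
  fix m assume m: "m \<in> carrier M" "r \<odot>\<^bsub>M\<^esub> m \<in> K" "m \<notin> K"
  obtain P where "P \<in> assoc_primes K" "elem_colon K m \<subseteq> P"
    using m by (meson K assoc_prime_above)
  then show False
    using av m r by (auto simp: elem_colon_def)
qed

end

section \<open>Prime avoidance in a coset\<close>

lemma (in cring) common_element_outside_prime: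
  assumes P: "primeideal P R" and "finite F"
    and "\<And>Q. Q \<in> F \<Longrightarrow> ideal Q R" "\<And>Q. Q \<in> F \<Longrightarrow> \<not> Q \<subseteq> P"
  shows "\<exists>a\<in>carrier R. a \<notin> P \<and> (\<forall>Q\<in>F. a \<in> Q)"
  using assms(2-)
proof (induction F)
  case empty
  interpret primeideal P R by (rule P)
  have "\<one> \<notin> P"
    using one_imp_carrier I_notcarr by blast
  then show ?case by blast
next
  case (insert Q F)
  obtain a where a: "a \<in> carrier R" "a \<notin> P" "\<forall>Q\<in>F. a \<in> Q"
    using insert.IH insert.prems by blast
  obtain b where b: "b \<in> Q" "b \<notin> P"
    using insert.prems by blast
  have Q: "ideal Q R"
    using insert.prems by simp
  have bc: "b \<in> carrier R"
    using ideal.Icarr[OF Q b(1)] .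
  have "a \<otimes> b \<notin> P"
    using primeideal.I_prime[OF P a(1) bc] a(2) b(2) by blast
  moreover have "a \<otimes> b \<in> Q"
    using ideal.I_l_closed[OF Q b(1) a(1)] .
  moreover have "a \<otimes> b \<in> Q'" if "Q' \<in> F" for Q'
    using ideal.I_r_closed[of Q' R a b] insert.prems(1)[of Q'] that a(3) bc by simp
  ultimately show ?case
    using a bc by blast
qed

text \<open>An element of \<open>x + J\<close> that avoids all primes of \<open>F\<close> but \<open>P\<close> is corrected by \<open>a b\<close>, with \<open>b \<in> J\<close>
  outside \<open>P\<close> and \<open>a \<notin> P\<close> in all the other primes. The correction stays in the coset, so that
  in an ideal \<open>(x) + J\<close> the generator \<open>x\<close> can be exchanged for the new element.\<close>

lemma (in cring) coset_prime_avoidance: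
  assumes "finite F" "\<And>P. P \<in> F \<Longrightarrow> primeideal P R"
    and J: "ideal J R" and x: "x \<in> carrier R"
    and "\<And>P. P \<in> F \<Longrightarrow> x \<in> P \<Longrightarrow> \<not> J \<subseteq> P"
  shows "\<exists>j\<in>J. \<forall>P\<in>F. x \<oplus> j \<notin> P"
  using assms(1,2,5)
proof (induction F rule: finite_psubset_induct)
  case (psubset F)
  interpret J: ideal J R by (rule J)
  show ?case
  proof (cases "F = {}")
    case True
    then show ?thesis using J.zero_closed by blast
  next
    case False
    \<comment> \<open>Splitting off a minimal prime guarantees that none of the others is contained in it.\<close>
    obtain P where P: "P \<in> F" and min: "\<And>Q. Q \<in> F \<Longrightarrow> Q \<subseteq> P \<Longrightarrow> Q = P"
      using finite_has_minimal[OF psubset.hyps False] by metis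
    interpret P: primeideal P R by (rule psubset.prems(1)[OF P])
    obtain j where j: "j \<in> J" "\<forall>Q\<in>F - {P}. x \<oplus> j \<notin> Q"
      using psubset.IH[of "F - {P}"] P psubset.prems by blast
    have jc: "j \<in> carrier R"
      using j J.Icarr by blast
    show ?thesis
    proof (cases "x \<oplus> j \<in> P")
      case False
      then show ?thesis using j by blast
    next
      case True
      have "\<not> J \<subseteq> P"
      proof
        assume JP: "J \<subseteq> P"
        then have "(x \<oplus> j) \<ominus> j \<in> P"
          using True j P.a_closed P.a_inv_closed by (auto simp: a_minus_def)
        then have "x \<in> P"
          using x jc by (simp add: a_minus_def a_assoc r_neg)
        then show False
          using psubset.prems(2)[OF P] JP by blast
      qed
      then obtain b where b: "b \<in> J" "b \<notin> P"
        by blast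
      obtain a where a: "a \<in> carrier R" "a \<notin> P" "\<forall>Q\<in>F - {P}. a \<in> Q"
      proof -
        have "\<exists>a\<in>carrier R. a \<notin> P \<and> (\<forall>Q\<in>F - {P}. a \<in> Q)"
        proof (rule common_element_outside_prime)
          show "primeideal P R" by (rule P.primeideal)
          show "finite (F - {P})" using psubset.hyps by simp
          show "ideal Q R" if "Q \<in> F - {P}" for Q
            using that psubset.prems(1) primeideal.axioms(1) by blast
          show "\<not> Q \<subseteq> P" if "Q \<in> F - {P}" for Q
            using that min by blast
        qed
        then show ?thesis using that by blast
      qed
      have bc: "b \<in> carrier R"
        using b J.Icarr by blast
      have ab: "a \<otimes> b \<in> J"
        using J.I_l_closed a b by blast
      have eq: "x \<oplus> (j \<oplus> a \<otimes> b) = (x \<oplus> j) \<oplus> a \<otimes> b"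
        using x jc a bc by (simp add: a_assoc)
      have "x \<oplus> (j \<oplus> a \<otimes> b) \<notin> Q" if Q: "Q \<in> F" for Q
      proof (cases "Q = P")
        case True
        have "a \<otimes> b \<in> P" if "x \<oplus> (j \<oplus> a \<otimes> b) \<in> P"
        proof -
          have "((x \<oplus> j) \<oplus> a \<otimes> b) \<ominus> (x \<oplus> j) \<in> P"
            using that \<open>x \<oplus> j \<in> P\<close> eq P.a_closed P.a_inv_closed by (simp add: a_minus_def)
          moreover have "((x \<oplus> j) \<oplus> a \<otimes> b) \<ominus> (x \<oplus> j) = a \<otimes> b"
            using x jc a bc
            by (simp add: a_minus_def a_comm[of "x \<oplus> j" "a \<otimes> b"] a_assoc[of "a \<otimes> b"] r_neg
                del: a_assoc)
          ultimately show ?thesis by simp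
        qed
        then show ?thesis
          using True P.I_prime[OF a(1) bc] a b by blast
      next
        case False
        interpret Q: primeideal Q R by (rule psubset.prems(1)[OF Q])
        have abQ: "a \<otimes> b \<in> Q"
          using a bc Q False Q.I_r_closed by blast
        have "x \<oplus> j \<in> Q" if "x \<oplus> (j \<oplus> a \<otimes> b) \<in> Q"
        proof -
          have "((x \<oplus> j) \<oplus> a \<otimes> b) \<ominus> a \<otimes> b \<in> Q"
            using that abQ eq Q.a_closed Q.a_inv_closed by (simp add: a_minus_def)
          then show ?thesis
            using x jc a bc by (simp add: a_minus_def a_assoc r_neg)
        qed
        then show ?thesis
          using j Q False by blast
      qed
      then show ?thesis
        using J.a_closed[OF j(1) ab] by blast
    qed
  qed
qed

section \<open>Nakayama's lemma at a prime ideal\<close>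

context module
begin

text \<open>Nakayama's lemma for \<open>H/K\<close> localized at \<open>P\<close>, with denominators cleared: if \<open>H/K = P (H/K)\<close> after
  localization, then \<open>H/K\<close> vanishes there. The generators in \<open>S\<close> are removed one by one: an equation
  \<open>q g \<in> L\<close> with \<open>q \<notin> P\<close> makes the generator \<open>g\<close> superfluous at \<open>P\<close>.\<close>

lemma kill_outside_prime_generators:
  assumes P: "primeideal P R" and K: "submodule K R M" and H: "submodule H R M"
    and t: "t \<in> carrier R" "t \<notin> P"
    and tH: "\<And>h. h \<in> H \<Longrightarrow>
      t \<odot>\<^bsub>M\<^esub> h \<in> gen (K \<union> {p \<odot>\<^bsub>M\<^esub> h | p h. p \<in> P \<and> h \<in> H})"
    and "finite S" "S \<subseteq> H"
    and "\<exists>s\<in>carrier R - P. \<forall>h\<in>H. s \<odot>\<^bsub>M\<^esub> h \<in> gen (K \<union> S)"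
  shows "\<exists>s\<in>carrier R - P. \<forall>h\<in>H. s \<odot>\<^bsub>M\<^esub> h \<in> K"
  using assms(7-)
proof (induction S)
  case empty
  then show ?case using gen_of_submodule[OF K] by simp
next
  case (insert g S)
  note Pideal = primeideal.axioms(1)[OF P]
  note Kc = submodule_mem[OF K] and Hc = submodule_mem[OF H]
  define L where "L = gen (K \<union> S)"
  have g: "g \<in> H" "g \<in> carrier M" and KS: "K \<union> S \<subseteq> carrier M"
    using insert.prems Hc Kc by auto
  have L: "submodule L R M"
    unfolding L_def by (rule gen_submodule_submodule[OF KS])
  note Lc = submodule_mem[OF L]
  have KL: "K \<subseteq> L"
    unfolding L_def using gen_superset by blast
  obtain s where s: "s \<in> carrier R" "s \<notin> P"
    and sH: "\<And>h. h \<in> H \<Longrightarrow> s \<odot>\<^bsub>M\<^esub> h \<in> gen (insert g L)"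
    using insert.prems(2) gen_insert_gen[OF KS g(2)] unfolding L_def by auto
  \<comment> \<open>The elements that \<open>s\<close> maps into \<open>L + P g\<close> form a submodule that contains \<open>K\<close> and \<open>P H\<close>,
    hence also \<open>t g\<close>.\<close>
  define T where "T = {b \<oplus>\<^bsub>M\<^esub> r \<odot>\<^bsub>M\<^esub> g | b r. b \<in> L \<and> r \<in> P}"
  have T: "submodule T R M"
    unfolding T_def by (rule plus_ideal_smult_submodule[OF L Pideal g(2)])
  have "K \<union> {p \<odot>\<^bsub>M\<^esub> h | p h. p \<in> P \<and> h \<in> H} \<subseteq> scalar_colon T s"
  proof
    fix z assume "z \<in> K \<union> {p \<odot>\<^bsub>M\<^esub> h | p h. p \<in> P \<and> h \<in> H}"
    then consider "z \<in> K" | p h where "p \<in> P" "h \<in> H" "z = p \<odot>\<^bsub>M\<^esub> h" by blast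
    then show "z \<in> scalar_colon T s"
    proof cases
      case 1
      have sz: "s \<odot>\<^bsub>M\<^esub> z \<in> L"
        using submodule_smult[OF K s(1) 1] KL by blast
      have "\<zero> \<in> P"
        using additive_subgroup.zero_closed[OF ideal.axioms(1)[OF Pideal]] .
      moreover have "s \<odot>\<^bsub>M\<^esub> z = s \<odot>\<^bsub>M\<^esub> z \<oplus>\<^bsub>M\<^esub> \<zero> \<odot>\<^bsub>M\<^esub> g"
        using g Lc[OF sz] by simp
      ultimately have "s \<odot>\<^bsub>M\<^esub> z \<in> T"
        unfolding T_def using sz by blast
      then show ?thesis
        using Kc[OF 1] by (simp add: scalar_colon_def)
    next
      case 2
      have pc: "p \<in> carrier R"
        using ideal.Icarr[OF Pideal 2(1)] .
      obtain l r where lr: "l \<in> L" "r \<in> carrier R" "s \<odot>\<^bsub>M\<^esub> h = l \<oplus>\<^bsub>M\<^esub> r \<odot>\<^bsub>M\<^esub> g"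
        using sH[OF 2(2)] L g(2) by (rule gen_insertE)
      have "s \<odot>\<^bsub>M\<^esub> z = p \<odot>\<^bsub>M\<^esub> (s \<odot>\<^bsub>M\<^esub> h)"
        using 2 pc s Hc by (simp add: smult_left_comm)
      also have "\<dots> = p \<odot>\<^bsub>M\<^esub> l \<oplus>\<^bsub>M\<^esub> (p \<otimes> r) \<odot>\<^bsub>M\<^esub> g"
        using lr pc g Lc by (simp add: smult_r_distr smult_assoc1)
      finally have "s \<odot>\<^bsub>M\<^esub> z \<in> T"
        unfolding T_def
        using submodule_smult[OF L pc lr(1)] ideal.I_r_closed[OF Pideal 2(1) lr(2)] by blast
      then show ?thesis
        using 2 pc Hc by (simp add: scalar_colon_def)
    qed
  qed
  then have "t \<odot>\<^bsub>M\<^esub> g \<in> scalar_colon T s"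
    using gen_least[OF scalar_colon_submodule[OF T s(1)]] tH[OF g(1)] by blast
  then obtain l p where lp: "l \<in> L" "p \<in> P" "s \<odot>\<^bsub>M\<^esub> (t \<odot>\<^bsub>M\<^esub> g) = l \<oplus>\<^bsub>M\<^esub> p \<odot>\<^bsub>M\<^esub> g"
    by (auto simp: scalar_colon_def T_def)
  have pc: "p \<in> carrier R"
    using ideal.Icarr[OF Pideal lp(2)] .
  define q where "q = s \<otimes> t \<ominus> p"
  have qc: "q \<in> carrier R"
    using s t pc by (simp add: q_def)
  have q: "q \<notin> P"
  proof
    assume "q \<in> P"
    then have "q \<oplus> p \<in> P"
      using additive_subgroup.a_closed[OF ideal.axioms(1)[OF Pideal]] lp(2) by blast
    moreover have "q \<oplus> p = s \<otimes> t"
      using s t pc by (simp add: q_def a_minus_def R.a_assoc R.l_neg)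
    ultimately show False
      using primeideal.I_prime[OF P s(1) t(1)] s t by simp
  qed
  have qg: "q \<odot>\<^bsub>M\<^esub> g \<in> L"
  proof -
    have "q \<odot>\<^bsub>M\<^esub> g = (l \<oplus>\<^bsub>M\<^esub> p \<odot>\<^bsub>M\<^esub> g) \<ominus>\<^bsub>M\<^esub> p \<odot>\<^bsub>M\<^esub> g"
      using s t pc g lp(3) by (simp add: q_def smult_l_diff smult_assoc1)
    then show ?thesis
      using lp(1) Lc pc g by (simp add: add_diff_cancel)
  qed
  have "(q \<otimes> s) \<odot>\<^bsub>M\<^esub> h \<in> L" if h: "h \<in> H" for h
  proof -
    obtain l r where lr: "l \<in> L" "r \<in> carrier R" "s \<odot>\<^bsub>M\<^esub> h = l \<oplus>\<^bsub>M\<^esub> r \<odot>\<^bsub>M\<^esub> g"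
      using sH[OF h] L g(2) by (rule gen_insertE)
    have "(q \<otimes> s) \<odot>\<^bsub>M\<^esub> h = q \<odot>\<^bsub>M\<^esub> l \<oplus>\<^bsub>M\<^esub> r \<odot>\<^bsub>M\<^esub> (q \<odot>\<^bsub>M\<^esub> g)"
      using lr qc s h Hc Lc g by (simp add: smult_assoc1 smult_r_distr smult_left_comm[of q r])
    then show ?thesis
      using submodule_add[OF L submodule_smult[OF L qc lr(1)] submodule_smult[OF L lr(2) qg]]
      by simp
  qed
  moreover have "q \<otimes> s \<in> carrier R - P"
    using primeideal.I_prime[OF P qc s(1)] q s qc by blast
  ultimately show ?case
    using insert.IH insert.prems(1) unfolding L_def by blast
qed

end

lemma (in fg_noetherian_module) kill_outside_prime:
  assumes P: "primeideal P R" and K: "submodule K R M" and H: "submodule H R M"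
    and t: "t \<in> carrier R" "t \<notin> P"
    and tH: "\<And>h. h \<in> H \<Longrightarrow>
      t \<odot>\<^bsub>M\<^esub> h \<in> gen (K \<union> {p \<odot>\<^bsub>M\<^esub> h | p h. p \<in> P \<and> h \<in> H})"
  obtains s where "s \<in> carrier R" "s \<notin> P" "\<And>h. h \<in> H \<Longrightarrow> s \<odot>\<^bsub>M\<^esub> h \<in> K"
proof -
  obtain S where S: "S \<subseteq> H" "finite S" "H = gen S"
    using H by (rule submodule_fg)
  have "\<one> \<in> carrier R - P"
    using ideal.one_imp_carrier[OF primeideal.axioms(1)[OF P]] primeideal.I_notcarr[OF P] by blast
  moreover have "\<one> \<odot>\<^bsub>M\<^esub> h \<in> gen (K \<union> S)" if "h \<in> H" for h
    using that gen_mono[of S "K \<union> S"] S submodule_mem[OF H that] by auto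
  ultimately have "\<exists>s\<in>carrier R - P. \<forall>h\<in>H. s \<odot>\<^bsub>M\<^esub> h \<in> gen (K \<union> S)" by blast
  from kill_outside_prime_generators[OF P K H t tH S(2,1) this] that show ?thesis by blast
qed

section \<open>Modules over a Noetherian local ring\<close>

locale noetherian_local_module = fg_noetherian_module R M + local_ring R \<mm>
  for R (structure) and M (structure) and \<mm>
begin

lemma maximal_prime: "primeideal \<mm> R"
  using maximalideal_axioms by (rule R.maximalideal_prime)

text \<open>A proper ideal that contains \<open>s\<close> lies in a maximal ideal, and \<open>\<mm>\<close> is the only one.\<close>

lemma unit_outside_maximal:
  assumes s: "s \<in> carrier R" "s \<notin> \<mm>"
  obtains v where "v \<in> carrier R" "v \<otimes> s = \<one>"
proof (rule ccontr)
  assume no: "\<not> thesis"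
  define F where "F = {I. ideal I R \<and> s \<in> I \<and> \<one> \<notin> I}"
  have "\<one> \<notin> PIdl s"
  proof
    assume "\<one> \<in> PIdl s"
    then obtain v where "v \<in> carrier R" "\<one> = v \<otimes> s"
      unfolding cgenideal_def by blast
    then show False
      using no that[of v] by simp
  qed
  then have "F \<noteq> {}"
    using cgenideal_ideal[OF s(1)] cgenideal_self[OF s(1)] by (auto simp: F_def)
  moreover have "ideal I R" if "I \<in> F" for I
    using that by (simp add: F_def)
  ultimately have "\<exists>I\<in>F. \<forall>J\<in>F. I \<subseteq> J \<longrightarrow> J = I"
    by (rule ideal_maximal_exists)
  then obtain I where I: "I \<in> F" "\<forall>J\<in>F. I \<subseteq> J \<longrightarrow> J = I" ..
  have "maximalideal I R"
  proof (rule maximalidealI)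
    show "ideal I R"
      using I by (simp add: F_def)
    show "carrier R \<noteq> I"
      using I(1) by (auto simp: F_def)
    fix J assume J: "ideal J R" "I \<subseteq> J"
    show "J = I \<or> J = carrier R"
    proof (cases "\<one> \<in> J")
      case True
      then show ?thesis using ideal.one_imp_carrier[OF J(1)] by blast
    next
      case False
      then have "J \<in> F"
        using J I(1) by (auto simp: F_def)
      then show ?thesis using I J by blast
    qed
  qed
  then have "I = \<mm>"
    by (rule maximal_unique)
  then show False
    using I(1) s by (simp add: F_def)
qed

lemma nakayama:
  assumes K: "submodule K R M" and H: "submodule H R M" and x: "x \<in> \<mm>"
    and HxH: "H \<subseteq> plus_mult K x H"
  shows "H \<subseteq> K"
proof -
  have "\<one> \<notin> \<mm>"
    using ideal.one_imp_carrier[OF primeideal.axioms(1)[OF maximal_prime]]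
      primeideal.I_notcarr[OF maximal_prime] by blast
  define G where "G = gen (K \<union> {p \<odot>\<^bsub>M\<^esub> h | p h. p \<in> \<mm> \<and> h \<in> H})"
  have G: "submodule G R M"
    unfolding G_def using submodule_mem[OF K] submodule_mem[OF H] Icarr
    by (intro gen_submodule_submodule) auto
  have "plus_mult K x H \<subseteq> G"
    by (rule plus_mult_least[OF G]) (use x in \<open>auto simp: G_def intro: genI\<close>)
  then have 1: "\<one> \<odot>\<^bsub>M\<^esub> h \<in> gen (K \<union> {p \<odot>\<^bsub>M\<^esub> h | p h. p \<in> \<mm> \<and> h \<in> H})" if "h \<in> H" for h
    using that HxH submodule_mem[OF H that] unfolding G_def by auto
  obtain s where s: "s \<in> carrier R" "s \<notin> \<mm>" "\<And>h. h \<in> H \<Longrightarrow> s \<odot>\<^bsub>M\<^esub> h \<in> K"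
    using kill_outside_prime[OF maximal_prime K H _ \<open>\<one> \<notin> \<mm>\<close> 1] by blast
  obtain v where v: "v \<in> carrier R" "v \<otimes> s = \<one>"
    using s(1,2) by (rule unit_outside_maximal)
  show "H \<subseteq> K"
  proof
    fix h assume h: "h \<in> H"
    have "h = v \<odot>\<^bsub>M\<^esub> (s \<odot>\<^bsub>M\<^esub> h)"
      using v s(1) submodule_mem[OF H h] by (simp add: smult_assoc1[symmetric])
    then show "h \<in> K"
      using submodule_smult[OF K v(1) s(3)[OF h]] by simp
  qed
qed

section \<open>Regular sequences\<close>

lemma exists_regular_avoiding:
  assumes F: "finite F" and sub: "\<And>K. K \<in> F \<Longrightarrow> submodule K R M"
    and J: "ideal J R" and x: "x \<in> carrier R"
    and no: "\<And>K P. K \<in> F \<Longrightarrow> P \<in> assoc_primes K \<Longrightarrow> x \<in> P \<Longrightarrow> \<not> J \<subseteq> P"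
  obtains j where "j \<in> J" "\<And>K. K \<in> F \<Longrightarrow> regular_mod K (x \<oplus> j)"
proof -
  have "\<exists>j\<in>J. \<forall>P\<in>\<Union>(assoc_primes ` F). x \<oplus> j \<notin> P"
  proof (rule R.coset_prime_avoidance[OF _ _ J x])
    show "finite (\<Union>(assoc_primes ` F))"
      using F sub finite_assoc_primes by simp
    show "primeideal P R" if "P \<in> \<Union>(assoc_primes ` F)" for P
      using that by (auto simp: assoc_primes_def)
    show "\<not> J \<subseteq> P" if "P \<in> \<Union>(assoc_primes ` F)" "x \<in> P" for P
      using that no by blast
  qed
  then obtain j where j: "j \<in> J" "\<forall>P\<in>\<Union>(assoc_primes ` F). x \<oplus> j \<notin> P" ..
  have "x \<oplus> j \<in> carrier R"
    using x ideal.Icarr[OF J j(1)] by simp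
  then have "regular_mod K (x \<oplus> j)" if "K \<in> F" for K
    using that sub j(2) by (intro regular_mod_if_avoids_assoc_primes) auto
  then show ?thesis
    using that j(1) by blast
qed

lemma regular_not_in_assoc_prime:
  assumes K: "submodule K R M" and "regular_mod K y" and P: "P \<in> assoc_primes K"
  shows "y \<notin> P"
proof
  assume yP: "y \<in> P"
  obtain u where u: "u \<in> carrier M" "P = elem_colon K u" and "primeideal P R"
    using P by (auto simp: assoc_primes_def)
  have "y \<odot>\<^bsub>M\<^esub> u \<in> K"
    using yP u(2) unfolding elem_colon_def by blast
  then have "u \<in> K"
    using assms(2) u(1) by (simp add: regular_mod_def)
  then have "carrier R = P"
    using u(2) submodule_smult[OF K] unfolding elem_colon_def by blast
  then show False
    using primeideal.I_notcarr[OF \<open>primeideal P R\<close>] by simp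
qed

text \<open>\<open>\<mm>\<close> is not an associated prime of \<open>M/K\<close>.\<close>

definition no_socle :: "'c set \<Rightarrow> bool"
  where "no_socle K \<longleftrightarrow> (\<forall>u\<in>carrier M. (\<forall>a\<in>\<mm>. a \<odot>\<^bsub>M\<^esub> u \<in> K) \<longrightarrow> u \<in> K)"

lemma no_socle_if_regular: "y \<in> \<mm> \<Longrightarrow> regular_mod K y \<Longrightarrow> no_socle K"
  by (auto simp: no_socle_def regular_mod_def)

lemma no_socle_assoc_prime:
  assumes K: "submodule K R M" and "no_socle K" and P: "P \<in> assoc_primes K"
  shows "\<not> \<mm> \<subseteq> P"
proof
  assume mP: "\<mm> \<subseteq> P"
  obtain u where u: "u \<in> carrier M" "P = elem_colon K u" and "primeideal P R"
    using P by (auto simp: assoc_primes_def)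
  have "\<forall>a\<in>\<mm>. a \<odot>\<^bsub>M\<^esub> u \<in> K"
    using mP u(2) unfolding elem_colon_def by blast
  then have "u \<in> K"
    using assms(2) u(1) by (simp add: no_socle_def)
  then have "carrier R = P"
    using u(2) submodule_smult[OF K] unfolding elem_colon_def by blast
  then show False
    using primeideal.I_notcarr[OF \<open>primeideal P R\<close>] by simp
qed

text \<open>For regular \<open>x\<close> and \<open>y\<close>, whether \<open>\<mm>\<close> is an associated prime of \<open>L/xL\<close> or of \<open>L/yL\<close>, where
  \<open>L = M/K\<close>, amounts to the same: if \<open>\<mm> u \<subseteq> xL\<close>, then \<open>y u = x v\<close> for some \<open>v\<close> with
  \<open>\<mm> v \<subseteq> yL\<close>, and \<open>v \<in> yL\<close> would give \<open>u \<in> xL\<close>.\<close>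

lemma no_socle_exchange:
  assumes K: "submodule K R M" and x: "x \<in> \<mm>" "regular_mod K x" and y: "y \<in> \<mm>" "regular_mod K y"
    and ns: "no_socle (plus_times K {y})"
  shows "no_socle (plus_times K {x})"
  unfolding no_socle_def
proof (intro ballI impI)
  fix u assume u: "u \<in> carrier M" and soc: "\<forall>a\<in>\<mm>. a \<odot>\<^bsub>M\<^esub> u \<in> plus_times K {x}"
  have xc: "x \<in> carrier R" and yc: "y \<in> carrier R"
    using x y Icarr by auto
  have Ky: "submodule (plus_times K {y}) R M" and Kx: "submodule (plus_times K {x}) R M"
    using K xc yc by (auto intro: plus_times_submodule)
  \<comment> \<open>\<open>y u = k + x v\<close>, and \<open>v\<close> is in the socle modulo \<open>K + y M\<close>.\<close>
  obtain k v where v: "k \<in> K" "v \<in> carrier M" "y \<odot>\<^bsub>M\<^esub> u = k \<oplus>\<^bsub>M\<^esub> x \<odot>\<^bsub>M\<^esub> v"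
    using soc y(1) K xc by (meson plus_times_singletonE)
  have "a \<odot>\<^bsub>M\<^esub> v \<in> plus_times K {y}" if a: "a \<in> \<mm>" for a
  proof -
    have ac: "a \<in> carrier R" using a Icarr by blast
    obtain k' w where w: "k' \<in> K" "w \<in> carrier M" "a \<odot>\<^bsub>M\<^esub> u = k' \<oplus>\<^bsub>M\<^esub> x \<odot>\<^bsub>M\<^esub> w"
      using soc a K xc by (meson plus_times_singletonE)
    have kc: "k \<in> carrier M" "k' \<in> carrier M"
      using v w submodule_mem[OF K] by auto
    \<comment> \<open>\<open>x (a v - y w) = (a y u - a k) - (y a u - y k') \<in> K\<close>\<close>
    have "x \<odot>\<^bsub>M\<^esub> (a \<odot>\<^bsub>M\<^esub> v) = a \<odot>\<^bsub>M\<^esub> (y \<odot>\<^bsub>M\<^esub> u) \<ominus>\<^bsub>M\<^esub> a \<odot>\<^bsub>M\<^esub> k"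
      using v xc ac kc by (simp add: smult_r_distr add_diff_cancel_left smult_left_comm)
    moreover have "x \<odot>\<^bsub>M\<^esub> (y \<odot>\<^bsub>M\<^esub> w) = y \<odot>\<^bsub>M\<^esub> (a \<odot>\<^bsub>M\<^esub> u) \<ominus>\<^bsub>M\<^esub> y \<odot>\<^bsub>M\<^esub> k'"
      using w xc yc kc by (simp add: smult_r_distr add_diff_cancel_left smult_left_comm)
    ultimately have "x \<odot>\<^bsub>M\<^esub> (a \<odot>\<^bsub>M\<^esub> v \<ominus>\<^bsub>M\<^esub> y \<odot>\<^bsub>M\<^esub> w) = y \<odot>\<^bsub>M\<^esub> k' \<ominus>\<^bsub>M\<^esub> a \<odot>\<^bsub>M\<^esub> k"
      using v(2) w(2) xc yc ac kc u
      by (simp add: smult_r_diff smult_left_comm[of a y] diff_diff_cancel_left)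
    then have "a \<odot>\<^bsub>M\<^esub> v \<ominus>\<^bsub>M\<^esub> y \<odot>\<^bsub>M\<^esub> w \<in> K"
      using x(2) v(1,2) w(1,2) ac yc submodule_diff[OF K] submodule_smult[OF K]
      by (simp add: regular_mod_def)
    then have "a \<odot>\<^bsub>M\<^esub> v \<ominus>\<^bsub>M\<^esub> y \<odot>\<^bsub>M\<^esub> w \<in> plus_times K {y}"
      by (rule subsetD[OF plus_times_superset])
    then show ?thesis
      using submodule_diff_cancel[OF Ky] plus_times_smult[of y "{y}" w] w v ac by blast
  qed
  then have "v \<in> plus_times K {y}"
    using ns v(2) by (simp add: no_socle_def)
  then obtain k'' w where w: "k'' \<in> K" "w \<in> carrier M" "v = k'' \<oplus>\<^bsub>M\<^esub> y \<odot>\<^bsub>M\<^esub> w"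
    using K yc by (rule plus_times_singletonE)
  have kc: "k \<in> carrier M" "k'' \<in> carrier M"
    using v w submodule_mem[OF K] by auto
  have "y \<odot>\<^bsub>M\<^esub> (u \<ominus>\<^bsub>M\<^esub> x \<odot>\<^bsub>M\<^esub> w) = k \<oplus>\<^bsub>M\<^esub> x \<odot>\<^bsub>M\<^esub> k''"
    using v(3) w u xc yc kc
    by (simp add: smult_r_diff smult_r_distr smult_left_comm[of y x] M.a_assoc[symmetric]
        add_diff_cancel)
  then have "u \<ominus>\<^bsub>M\<^esub> x \<odot>\<^bsub>M\<^esub> w \<in> K"
    using y(2) u v(1) w(1,2) xc submodule_add[OF K] submodule_smult[OF K]
    by (simp add: regular_mod_def)
  then have "u \<ominus>\<^bsub>M\<^esub> x \<odot>\<^bsub>M\<^esub> w \<in> plus_times K {x}"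
    by (rule subsetD[OF plus_times_superset])
  then show "u \<in> plus_times K {x}"
    using submodule_diff_cancel[OF Kx] plus_times_smult[of x "{x}" w] w u by blast
qed

text \<open>\<open>M/K\<close> has a regular sequence of length \<open>n\<close> in \<open>\<mm>\<close>. The last quotient
  may be zero, so that the zero module qualifies for every \<open>n\<close>, in accordance with
  depth \<open>\<infinity>\<close>.\<close>

primrec depth_ge :: "nat \<Rightarrow> 'c set \<Rightarrow> bool"
  where "depth_ge 0 K \<longleftrightarrow> True"
  | "depth_ge (Suc n) K \<longleftrightarrow> (\<exists>y\<in>\<mm>. regular_mod K y \<and> depth_ge n (plus_times K {y}))"

text \<open>A regular sequence \<open>y, z\<close> may be swapped once \<open>z\<close> is known to be regular by itself: if
  \<open>y u = z v\<close>, then \<open>v = y w\<close>, and cancelling \<open>y\<close> leaves \<open>u = z w\<close>.\<close>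

lemma regular_swap:
  assumes K: "submodule K R M" and yc: "y \<in> carrier R" and zc: "z \<in> carrier R"
    and y: "regular_mod K y" and zK: "regular_mod K z" and z: "regular_mod (plus_times K {y}) z"
  shows "regular_mod (plus_times K {z}) y"
  unfolding regular_mod_def
proof (intro ballI impI)
  fix u assume u: "u \<in> carrier M" "y \<odot>\<^bsub>M\<^esub> u \<in> plus_times K {z}"
  note Kc = submodule_mem[OF K]
  have Ky: "submodule (plus_times K {y}) R M" and Kz: "submodule (plus_times K {z}) R M"
    using K zc yc by (auto intro: plus_times_submodule)
  obtain k v where v: "k \<in> K" "v \<in> carrier M" "y \<odot>\<^bsub>M\<^esub> u = k \<oplus>\<^bsub>M\<^esub> z \<odot>\<^bsub>M\<^esub> v"
    using u(2) K zc by (rule plus_times_singletonE)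
  have "k \<oplus>\<^bsub>M\<^esub> z \<odot>\<^bsub>M\<^esub> v \<in> plus_times K {y}"
    using plus_times_smult[of y "{y}" u K] u v by simp
  then have "z \<odot>\<^bsub>M\<^esub> v \<in> plus_times K {y}"
    using submodule_add_cancel_left[OF Ky] v zc subsetD[OF plus_times_superset v(1)] by blast
  then have "v \<in> plus_times K {y}"
    using z v by (simp add: regular_mod_def)
  then obtain k' w where w: "k' \<in> K" "w \<in> carrier M" "v = k' \<oplus>\<^bsub>M\<^esub> y \<odot>\<^bsub>M\<^esub> w"
    using K yc by (rule plus_times_singletonE)
  have kc: "k \<in> carrier M" "k' \<in> carrier M"
    using v w Kc by auto
  have "y \<odot>\<^bsub>M\<^esub> (u \<ominus>\<^bsub>M\<^esub> z \<odot>\<^bsub>M\<^esub> w) = k \<oplus>\<^bsub>M\<^esub> z \<odot>\<^bsub>M\<^esub> k'"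
    using v(3) w u yc zc kc
    by (simp add: smult_r_diff smult_r_distr smult_left_comm[of y z] M.a_assoc[symmetric]
        add_diff_cancel)
  then have "u \<ominus>\<^bsub>M\<^esub> z \<odot>\<^bsub>M\<^esub> w \<in> K"
    using y u v(1) w(1,2) zc submodule_add[OF K] submodule_smult[OF K]
    by (simp add: regular_mod_def)
  then have "u \<ominus>\<^bsub>M\<^esub> z \<odot>\<^bsub>M\<^esub> w \<in> plus_times K {z}"
    by (rule subsetD[OF plus_times_superset])
  then show "u \<in> plus_times K {z}"
    using submodule_diff_cancel[OF Kz] plus_times_smult[of z "{z}" w] w u by blast
qed

text \<open>Depth drops by at most one modulo any regular element \<open>x\<close>, not only modulo the first element \<open>y\<close>
  of a given regular sequence. The link between \<open>x\<close> and \<open>y\<close> is an element \<open>z\<close> that is regular on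
  \<open>L = M/K\<close>, on \<open>L/xL\<close> and on \<open>L/yL\<close>. It exists by prime avoidance, because \<open>\<mm>\<close> is not associated to any of
  them, for \<open>L/xL\<close> by the exchange of socles. The induction hypothesis for \<open>L/yL\<close> passes to
  \<open>L/(y,z)L\<close>, and that for \<open>L/zL\<close> passes from there to \<open>L/(z,x)L\<close>.\<close>

lemma depth_ge_exchange:
  assumes "submodule K R M" "depth_ge (Suc n) K" "x \<in> \<mm>" "regular_mod K x"
  shows "depth_ge n (plus_times K {x})"
  using assms
proof (induction n arbitrary: K x)
  case 0
  then show ?case by simp
next
  case (Suc n)
  note K = Suc.prems(1) and x = Suc.prems(3,4)
  obtain y where y: "y \<in> \<mm>" "regular_mod K y" "depth_ge (Suc n) (plus_times K {y})"
    using Suc.prems(2) by auto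
  have xc: "x \<in> carrier R" and yc: "y \<in> carrier R"
    using x y Icarr by auto
  have Ky: "submodule (plus_times K {y}) R M" and Kx: "submodule (plus_times K {x}) R M"
    using K xc yc by (auto intro: plus_times_submodule)
  have nsy: "no_socle (plus_times K {y})"
    using y(3) no_socle_if_regular by auto
  then have nsx: "no_socle (plus_times K {x})"
    using no_socle_exchange[OF K x y(1,2)] by blast
  have ns: "no_socle K"
    using no_socle_if_regular x by blast
  obtain j where j: "j \<in> \<mm>"
    "\<And>L. L \<in> {K, plus_times K {x}, plus_times K {y}} \<Longrightarrow> regular_mod L (\<zero> \<oplus> j)"
  proof (rule exists_regular_avoiding[of "{K, plus_times K {x}, plus_times K {y}}" \<mm> \<zero>])
    show "submodule L R M" if "L \<in> {K, plus_times K {x}, plus_times K {y}}" for L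
      using that K Kx Ky by blast
    show "\<not> \<mm> \<subseteq> P" if "L \<in> {K, plus_times K {x}, plus_times K {y}}" "P \<in> assoc_primes L" for L P
      using that no_socle_assoc_prime K Kx Ky ns nsx nsy by blast
  qed (auto simp: is_ideal)
  define z where "z = \<zero> \<oplus> j"
  have zc: "z \<in> carrier R" and zm: "z \<in> \<mm>"
    using j(1) Icarr by (auto simp: z_def)
  have z: "regular_mod K z" "regular_mod (plus_times K {x}) z" "regular_mod (plus_times K {y}) z"
    using j(2) unfolding z_def by simp_all
  have Kz: "submodule (plus_times K {z}) R M"
    using K zc by (auto intro: plus_times_submodule)
  have swap: "plus_times (plus_times K {a}) {b} = plus_times (plus_times K {b}) {a}"
    if "a \<in> carrier R" "b \<in> carrier R" for a b
    using that plus_times_plus_times[OF K, of "{a}" "{b}"] plus_times_plus_times[OF K, of "{b}" "{a}"]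
    by (simp add: insert_commute)
  have "depth_ge n (plus_times (plus_times K {y}) {z})"
    using Suc.IH[OF Ky y(3) zm z(3)] .
  then have "depth_ge (Suc n) (plus_times K {z})"
    using y(1) regular_swap[OF K yc zc y(2) z(1,3)] swap[OF yc zc] by auto
  then have "depth_ge n (plus_times (plus_times K {z}) {x})"
    using Suc.IH[OF Kz _ x(1)] regular_swap[OF K xc zc x(2) z(1,2)] by blast
  then show ?case
    using zm z(2) swap[OF xc zc] by auto
qed

end

section \<open>Chains of submodules\<close>

context module
begin

text \<open>\<open>H/B\<close> has length at least \<open>n\<close>: there is a strictly increasing chain with \<open>n\<close> steps that starts
  at \<open>B\<close> and stays inside \<open>H\<close>. Bounds on such \<open>n\<close> take the place of lengths, so that finiteness
  need not be known beforehand.\<close>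

inductive has_chain :: "'c set \<Rightarrow> 'c set \<Rightarrow> nat \<Rightarrow> bool"
  where refl: "submodule B R M \<Longrightarrow> submodule H R M \<Longrightarrow> B \<subseteq> H \<Longrightarrow> has_chain B H 0"
  | step: "submodule B R M \<Longrightarrow> B \<subset> B' \<Longrightarrow> has_chain B' H n \<Longrightarrow> has_chain B H (Suc n)"

lemma has_chainD:
  assumes "has_chain B H n"
  shows "submodule B R M" "submodule H R M" "B \<subseteq> H"
  using assms by (induction rule: has_chain.induct) auto

lemma has_chain_antimono:
  assumes "has_chain B' H n" "submodule B R M" "B \<subseteq> B'"
  shows "has_chain B H n"
  using assms
proof (cases rule: has_chain.cases)
  case refl
  then show ?thesis using assms has_chain.refl by blast
next
  case (step C m)
  then show ?thesis using assms has_chain.step[of B C H m] by blast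
qed

lemma has_chain_append:
  assumes "has_chain C K n" "has_chain K H e"
  shows "has_chain C H (n + e)"
  using assms
proof (induction arbitrary: e rule: has_chain.induct)
  case (refl B H')
  then show ?case using has_chain_antimono by simp
next
  case (step B B' H' n)
  then show ?case using has_chain.step by simp
qed

lemma has_chain_strict_image:
  assumes "has_chain X Y n" "submodule H R M"
    and "\<And>Z. submodule Z R M \<Longrightarrow> X \<subseteq> Z \<Longrightarrow> Z \<subseteq> Y \<Longrightarrow> submodule (f Z) R M \<and> f Z \<subseteq> H"
    and "\<And>Z Z'. submodule Z R M \<Longrightarrow> submodule Z' R M \<Longrightarrow> X \<subseteq> Z \<Longrightarrow> Z \<subset> Z' \<Longrightarrow> Z' \<subseteq> Y
      \<Longrightarrow> f Z \<subset> f Z'"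
  shows "has_chain (f X) H n"
  using assms
proof (induction rule: has_chain.induct)
  case (refl B Y)
  then show ?case by (intro has_chain.refl) auto
next
  case (step B B' Y n)
  note B'Y = has_chainD[OF step.hyps(3)]
  have sub: "B \<subseteq> B'" "B \<subseteq> Y"
    using step.hyps(2) B'Y by auto
  have "has_chain (f B') H n"
  proof (rule step.IH[OF step.prems(1)])
    show "submodule (f Z) R M \<and> f Z \<subseteq> H" if "submodule Z R M" "B' \<subseteq> Z" "Z \<subseteq> Y" for Z
      using step.prems(2)[of Z] that sub by blast
    show "f Z \<subset> f Z'"
      if "submodule Z R M" "submodule Z' R M" "B' \<subseteq> Z" "Z \<subset> Z'" "Z' \<subseteq> Y" for Z Z'
      using step.prems(3)[of Z Z'] that sub by blast
  qed
  moreover have "submodule (f B) R M"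
    using step.prems(2)[OF step.hyps(1)] sub by blast
  moreover have "f B \<subset> f B'"
    using step.prems(3)[OF step.hyps(1) B'Y(1) _ step.hyps(2) B'Y(3)] by blast
  ultimately show ?case
    by (intro has_chain.step)
qed

text \<open>The modular law: \<open>C \<subseteq> C'\<close> agree as soon as they have the same intersection and the same sum with
  \<open>D\<close>.\<close>

lemma plus_mult_one_modular:
  assumes C: "submodule C R M" and C': "submodule C' R M" and D: "submodule D R M"
    and "C \<subseteq> C'" "C' \<inter> D \<subseteq> C" "plus_mult C' \<one> D \<subseteq> plus_mult C \<one> D"
  shows "C' \<subseteq> C"
proof
  fix x assume x: "x \<in> C'"
  have "x \<in> plus_mult C \<one> D"
    using plus_mult_superset[OF C' D R.one_closed] x assms(6) by blast
  then obtain c d where cd: "c \<in> C" "d \<in> D" "x = c \<oplus>\<^bsub>M\<^esub> d"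
    by (rule plus_multE) (use submodule_mem[OF D] in auto)
  have "d \<in> C'"
    using submodule_add_cancel_left[OF C', of c d] cd x assms(4) submodule_mem[OF D] by blast
  then have "d \<in> C"
    using cd assms(5) by blast
  then show "x \<in> C"
    using cd submodule_add[OF C] by blast
qed

lemma has_chain_split_aux:
  assumes "has_chain C H n" "submodule D R M"
  shows "\<exists>i j. n \<le> i + j \<and> has_chain (C \<inter> D) D i \<and> has_chain (plus_mult C \<one> D) (plus_mult H \<one> D) j"
  using assms
proof (induction rule: has_chain.induct)
  case (refl B H)
  have "plus_mult B \<one> D \<subseteq> plus_mult H \<one> D"
    using refl by (auto simp: plus_mult_def)
  then have "has_chain (plus_mult B \<one> D) (plus_mult H \<one> D) 0"
    using refl by (intro has_chain.refl plus_mult_submodule) auto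
  moreover have "has_chain (B \<inter> D) D 0"
    using refl by (intro has_chain.refl submodule_Int) auto
  ultimately show ?case by blast
next
  case (step B B' H n)
  note D = step.prems
  obtain i j where ij: "n \<le> i + j" "has_chain (B' \<inter> D) D i"
    "has_chain (plus_mult B' \<one> D) (plus_mult H \<one> D) j"
    using step.IH D by blast
  have B': "submodule B' R M"
    using has_chainD[OF step.hyps(3)] by simp
  have BD: "submodule (B \<inter> D) R M" and BpD: "submodule (plus_mult B \<one> D) R M"
    using step.hyps(1) D by (auto intro: submodule_Int plus_mult_submodule)
  have le: "plus_mult B \<one> D \<subseteq> plus_mult B' \<one> D"
    using step.hyps(2) by (auto simp: plus_mult_def)
  show ?case
  proof (cases "B \<inter> D = B' \<inter> D")
    case True
    then have "\<not> plus_mult B' \<one> D \<subseteq> plus_mult B \<one> D"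
      using plus_mult_one_modular[OF step.hyps(1) B' D] step.hyps(2) by blast
    then have "plus_mult B \<one> D \<subset> plus_mult B' \<one> D"
      using le by blast
    then have "has_chain (plus_mult B \<one> D) (plus_mult H \<one> D) (Suc j)"
      using has_chain.step[OF BpD _ ij(3)] by blast
    moreover have "has_chain (B \<inter> D) D i"
      using True ij by simp
    ultimately show ?thesis
      using ij(1) by (metis Suc_le_mono add_Suc_right)
  next
    case False
    then have "B \<inter> D \<subset> B' \<inter> D"
      using step.hyps(2) by blast
    then have "has_chain (B \<inter> D) D (Suc i)"
      using has_chain.step[OF BD _ ij(2)] by blast
    moreover have "has_chain (plus_mult B \<one> D) (plus_mult H \<one> D) j"
      using has_chain_antimono[OF ij(3) BpD le] .
    ultimately show ?thesis
      using ij(1) by (metis Suc_le_mono add_Suc)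
  qed
qed

text \<open>Length is subadditive, \<open>\<ell>(H/C) \<le> \<ell>(D/C) + \<ell>(H/D)\<close>: by the modular law every step of a chain is
  still strict after intersecting with \<open>D\<close> or after adding \<open>D\<close>.\<close>

lemma has_chain_split:
  assumes ch: "has_chain C H n" and D: "submodule D R M" "C \<subseteq> D" "D \<subseteq> H"
  obtains i j where "n \<le> i + j" "has_chain C D i" "has_chain D H j"
proof -
  note CH = has_chainD[OF ch]
  have "plus_mult C \<one> D = D"
    using plus_mult_least[OF D(1,2), of D \<one>] plus_mult_smult[OF CH(1) D(1) R.one_closed]
      submodule_mem[OF D(1)] by force
  moreover have "plus_mult H \<one> D = H"
    using plus_mult_least[OF CH(2) subset_refl, of D \<one>] plus_mult_superset[OF CH(2) D(1) R.one_closed]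
      submodule_mem[OF D(1)] D(3) by force
  moreover have "C \<inter> D = C"
    using D by blast
  ultimately show ?thesis
    using has_chain_split_aux[OF ch D(1)] that by auto
qed

text \<open>Multiplication by \<open>r\<close> maps \<open>H/B\<close> onto \<open>(C + r H)/(C + r B)\<close>, so lengths can only decrease; chains
  pull back along it.\<close>

lemma has_chain_of_smult_image:
  assumes ch: "has_chain X Y n" and B: "submodule B R M" and H: "submodule H R M"
    and r: "r \<in> carrier R" and CX: "C \<subseteq> X" and Y: "Y \<subseteq> plus_mult C r H"
    and BX: "B \<subseteq> H" "\<And>b. b \<in> B \<Longrightarrow> r \<odot>\<^bsub>M\<^esub> b \<in> X"
  shows "has_chain B H n"
proof -
  define f where "f Z = H \<inter> scalar_colon Z r" for Z
  have f_sub: "submodule (f Z) R M" if "submodule Z R M" for Z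
    unfolding f_def by (intro submodule_Int H scalar_colon_submodule that r)
  have "has_chain (f X) H n"
  proof (rule has_chain_strict_image[OF ch H])
    show "submodule (f Z) R M \<and> f Z \<subseteq> H" if "submodule Z R M" for Z
      using f_sub[OF that] by (auto simp: f_def)
    fix Z Z' assume Z: "submodule Z R M" "submodule Z' R M" "X \<subseteq> Z" "Z \<subset> Z'" "Z' \<subseteq> Y"
    obtain z where z: "z \<in> Z'" "z \<notin> Z"
      using Z by blast
    have "z \<in> plus_mult C r H"
      using z(1) Z(5) Y by blast
    then obtain c h where ch: "c \<in> C" "h \<in> H" "z = c \<oplus>\<^bsub>M\<^esub> r \<odot>\<^bsub>M\<^esub> h"
      by (rule plus_multE)
    have hc: "h \<in> carrier M"
      using ch submodule_mem[OF H] by blast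
    have cZ: "c \<in> Z" "c \<in> Z'"
      using ch CX Z by auto
    have "r \<odot>\<^bsub>M\<^esub> h \<in> Z'"
      using submodule_add_cancel_left[OF Z(2) cZ(2)] z ch r hc by blast
    moreover have "r \<odot>\<^bsub>M\<^esub> h \<notin> Z"
      using submodule_add[OF Z(1) cZ(1)] z ch by blast
    ultimately show "f Z \<subset> f Z'"
      using Z(4) ch hc unfolding f_def scalar_colon_def by blast
  qed
  moreover have "B \<subseteq> f X"
    using BX submodule_mem[OF B] by (auto simp: f_def scalar_colon_def)
  ultimately show ?thesis
    using has_chain_antimono B by blast
qed

text \<open>Generators chosen one at a time outside the span of the previous ones form a strict chain, so
  \<open>\<mu>(H/B) \<le> \<ell>(H/B)\<close>.\<close>

lemma generators_of_bounded_chains: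
  assumes "submodule B R M" "submodule H R M" "B \<subseteq> H"
    and "\<And>n. has_chain B H n \<Longrightarrow> n \<le> c"
  shows "\<exists>S\<subseteq>H. finite S \<and> card S \<le> c \<and> H = gen (B \<union> S)"
  using assms
proof (induction c arbitrary: B)
  case 0
  have "B = H"
  proof (rule ccontr)
    assume "B \<noteq> H"
    then have "has_chain B H (Suc 0)"
      using 0 has_chain.step[OF _ _ has_chain.refl[of H H]] by blast
    then show False using 0(4) by fastforce
  qed
  then show ?case
    using gen_of_submodule[OF 0(1)] by (intro exI[of _ "{}"]) simp
next
  case (Suc c)
  show ?case
  proof (cases "B = H")
    case True
    then show ?thesis
      using gen_of_submodule[OF Suc.prems(1)] by (intro exI[of _ "{}"]) simp
  next
    case False
    then obtain u where u: "u \<in> H" "u \<notin> B"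
      using Suc.prems(3) by blast
    have uc: "u \<in> carrier M"
      using u submodule_mem[OF Suc.prems(2)] by blast
    have Bc: "B \<subseteq> carrier M"
      using submodule_mem[OF Suc.prems(1)] by blast
    define B' where "B' = gen (insert u B)"
    have B': "submodule B' R M"
      unfolding B'_def by (rule gen_insert_submodule[OF Suc.prems(1) uc])
    have BB': "B \<subset> B'"
      unfolding B'_def using genI[of u "insert u B"] gen_superset[of "insert u B"] u by blast
    have B'H: "B' \<subseteq> H"
      unfolding B'_def by (rule gen_least[OF Suc.prems(2)]) (use u Suc.prems(3) in blast)
    have "n \<le> c" if "has_chain B' H n" for n
      using Suc.prems(4)[OF has_chain.step[OF Suc.prems(1) BB' that]] by simp
    then obtain S where S: "S \<subseteq> H" "finite S" "card S \<le> c" "H = gen (B' \<union> S)"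
      using Suc.IH[OF B' Suc.prems(2) B'H] by blast
    have "H = gen (B \<union> insert u S)"
      using S(4) gen_Un_gen[of "insert u B" S] Bc uc S(1) submodule_mem[OF Suc.prems(2)]
      unfolding B'_def by auto
    moreover have "card (insert u S) \<le> Suc c"
      using S card_insert_le_m1[of "Suc c" S u] by simp
    ultimately show ?thesis
      using S u by (intro exI[of _ "insert u S"]) simp
  qed
qed

end

section \<open>One parameter\<close>

context fg_noetherian_module
begin

text \<open>The ascending chain of the \<open>(K : x\<^sup>n)\<close> stabilizes, at the saturation of \<open>K\<close> with respect to \<open>x\<close>.\<close>

lemma saturation_exists:
  assumes K: "submodule K R M" and x: "x \<in> carrier R"
  obtains H N where "submodule H R M" "K \<subseteq> H" "regular_mod H x"
    "\<And>h. h \<in> H \<Longrightarrow> (x [^] (N::nat)) \<odot>\<^bsub>M\<^esub> h \<in> K"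
proof -
  define F where "F = range (\<lambda>n::nat. scalar_colon K (x [^] n))"
  have "F \<noteq> {}"
    by (simp add: F_def)
  moreover have F: "submodule H R M" if "H \<in> F" for H
    using that K x by (auto simp: F_def intro: scalar_colon_submodule)
  ultimately have "\<exists>H\<in>F. \<forall>X\<in>F. H \<subseteq> X \<longrightarrow> X = H"
    by (rule submodule_maximal_exists)
  then obtain Z where Z: "Z \<in> F" "\<forall>X\<in>F. Z \<subseteq> X \<longrightarrow> X = Z" ..
  from Z(1) obtain N :: nat where "Z = scalar_colon K (x [^] N)"
    unfolding F_def ..
  with Z(2) have max: "X = scalar_colon K (x [^] N)"
    if "X \<in> F" "scalar_colon K (x [^] N) \<subseteq> X" for X
    using that by simp
  define H where "H = scalar_colon K (x [^] N)"
  have Suc_eq: "(x [^] Suc n) \<odot>\<^bsub>M\<^esub> m = x \<odot>\<^bsub>M\<^esub> ((x [^] n) \<odot>\<^bsub>M\<^esub> m)"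
    if "m \<in> carrier M" for m and n :: nat
    using x that by (simp add: smult_assoc1 smult_left_comm[of _ x])
  have "H \<subseteq> scalar_colon K (x [^] Suc N)"
    unfolding H_def scalar_colon_def
    using Suc_eq submodule_smult[OF K x] by auto
  then have Suc_H: "scalar_colon K (x [^] Suc N) = H"
    unfolding H_def F_def by (intro max[unfolded F_def] rangeI)
  show ?thesis
  proof
    show "submodule H R M"
      using F unfolding F_def H_def by blast
    show "K \<subseteq> H"
      using submodule_smult[OF K] submodule_mem[OF K] x by (auto simp: H_def scalar_colon_def)
    show "regular_mod H x"
      unfolding regular_mod_def
    proof (intro ballI impI)
      fix m assume m: "m \<in> carrier M" "x \<odot>\<^bsub>M\<^esub> m \<in> H"
      then have "(x [^] Suc N) \<odot>\<^bsub>M\<^esub> m \<in> K"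
        using x by (simp add: H_def scalar_colon_def smult_assoc1)
      then have "m \<in> scalar_colon K (x [^] Suc N)"
        using m by (simp add: scalar_colon_def)
      then show "m \<in> H"
        unfolding Suc_H .
    qed
    show "(x [^] N) \<odot>\<^bsub>M\<^esub> h \<in> K" if "h \<in> H" for h
      using that by (simp add: H_def scalar_colon_def)
  qed
qed

text \<open>\<open>\<ell>(K/(A + xK)) \<le> \<ell>(M/(A + xM))\<close>. Let \<open>H\<close> be the saturation of \<open>K\<close> and \<open>D = A + xH\<close>. Then
  \<open>\<ell>(H/K) + \<ell>(K/(A + xK)) \<le> \<ell>(D/(A + xK)) + \<ell>(H/D)\<close>, where \<open>\<ell>(D/(A + xK)) \<le> \<ell>(H/K)\<close> and
  \<open>\<ell>(H/D) \<le> \<ell>(M/(A + xM))\<close>. Cancelling \<open>\<ell>(H/K)\<close> requires that it is finite, which follows from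
  the filtration of \<open>H/K\<close> by powers of \<open>x\<close>.\<close>

lemma chains_submodule_one_parameter:
  assumes A: "submodule A R M" and K: "submodule K R M" and AK: "A \<subseteq> K" and x: "x \<in> carrier R"
    and bound: "\<And>n. has_chain (plus_times A {x}) (carrier M) n \<Longrightarrow> n \<le> c"
    and chain: "has_chain (plus_mult A x K) K n"
  shows "n \<le> c"
proof -
  obtain H N where H: "submodule H R M" and KH: "K \<subseteq> H" and reg: "regular_mod H x"
    and N: "\<And>h. h \<in> H \<Longrightarrow> (x [^] (N::nat)) \<odot>\<^bsub>M\<^esub> h \<in> K"
    using saturation_exists[OF K x] by blast
  note Kc = submodule_mem[OF K] and Hc = submodule_mem[OF H]
  define D where "D = plus_mult A x H"
  have D: "submodule D R M"
    unfolding D_def by (rule plus_mult_submodule[OF A H x])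
  have DH: "D \<subseteq> H"
    unfolding D_def using AK KH submodule_smult[OF H x] by (intro plus_mult_least[OF H]) auto
  have AD: "A \<subseteq> D"
    unfolding D_def by (rule plus_mult_superset[OF A H x])
  \<comment> \<open>\<open>H / (A + x H)\<close> embeds into \<open>M / (A + x M)\<close>.\<close>
  have top: "m \<le> c" if ch: "has_chain D H m" for m
  proof -
    have "has_chain (plus_mult D x (carrier M)) (carrier M) m"
    proof (rule has_chain_strict_image[OF ch carrier_is_submodule, where f = "\<lambda>Z. plus_mult Z x (carrier M)"])
      fix Z assume "submodule Z R M"
      then show "submodule (plus_mult Z x (carrier M)) R M \<and> plus_mult Z x (carrier M) \<subseteq> carrier M"
        using plus_mult_submodule[OF _ carrier_is_submodule x] submodule_mem by blast
    next
      fix Z Z' assume Z: "submodule Z R M" "submodule Z' R M" "D \<subseteq> Z" "Z \<subset> Z'" "Z' \<subseteq> H"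
      have "plus_mult Z x (carrier M) \<subseteq> plus_mult Z' x (carrier M)"
        using Z(4) by (auto simp: plus_mult_def)
      moreover obtain z where z: "z \<in> Z'" "z \<notin> Z"
        using Z(4) by blast
      moreover have "z \<notin> plus_mult Z x (carrier M)"
      proof
        assume "z \<in> plus_mult Z x (carrier M)"
        then obtain y m where ym: "y \<in> Z" "m \<in> carrier M" "z = y \<oplus>\<^bsub>M\<^esub> x \<odot>\<^bsub>M\<^esub> m"
          by (rule plus_multE)
        have "x \<odot>\<^bsub>M\<^esub> m \<in> H"
          using submodule_add_cancel_left[OF H, of y "x \<odot>\<^bsub>M\<^esub> m"] ym z Z x by blast
        then have "m \<in> H"
          using reg ym by (simp add: regular_mod_def)
        then have "x \<odot>\<^bsub>M\<^esub> m \<in> Z"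
          using plus_mult_smult[OF A H x] Z(3) unfolding D_def by blast
        then show False
          using submodule_add[OF Z(1)] ym z by blast
      qed
      moreover have "z \<in> plus_mult Z' x (carrier M)"
        using plus_mult_superset[OF Z(2) carrier_is_submodule x] z by blast
      ultimately show "plus_mult Z x (carrier M) \<subset> plus_mult Z' x (carrier M)"
        by blast
    qed
    moreover have "plus_times A {x} \<subseteq> plus_mult D x (carrier M)"
      using AD unfolding plus_times_singleton[OF A x] by (auto simp: plus_mult_def)
    moreover have "submodule (plus_times A {x}) R M"
      using A x by (intro plus_times_submodule) auto
    ultimately show ?thesis
      using bound has_chain_antimono by blast
  qed
  \<comment> \<open>\<open>H / K\<close> is filtered by the \<open>K + x^i H\<close>, whose factors are images of \<open>H / (A + x H)\<close>.\<close>
  have filt: "m \<le> i * c" if "has_chain (plus_mult K (x [^] i) H) H m" for i m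
    using that
  proof (induction i arbitrary: m)
    case 0
    have "plus_mult K (x [^] (0::nat)) H = H"
      using plus_mult_least[OF H KH, of H \<one>] plus_mult_smult[OF K H R.one_closed] Hc by force
    then have "has_chain H H m"
      using 0 by simp
    then show ?case
      by (cases rule: has_chain.cases) (use has_chainD in blast)+
  next
    case (Suc i)
    define E where "E = plus_mult K (x [^] i) H"
    have xi: "x [^] i \<in> carrier R"
      using x by simp
    have E: "submodule E R M"
      unfolding E_def by (rule plus_mult_submodule[OF K H xi])
    have Suc_eq: "(x [^] Suc i) \<odot>\<^bsub>M\<^esub> h = (x [^] i) \<odot>\<^bsub>M\<^esub> (x \<odot>\<^bsub>M\<^esub> h)" if "h \<in> H" for h
      using x Hc[OF that] by (simp add: smult_assoc1)
    have KE: "K \<subseteq> E"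
      unfolding E_def by (rule plus_mult_superset[OF K H xi])
    have "plus_mult K (x [^] Suc i) H \<subseteq> E"
    proof (rule plus_mult_least[OF E KE])
      fix h assume h: "h \<in> H"
      then show "(x [^] Suc i) \<odot>\<^bsub>M\<^esub> h \<in> E"
        using plus_mult_smult[OF K H xi submodule_smult[OF H x h]] Suc_eq unfolding E_def by simp
    qed
    moreover have "E \<subseteq> H"
      unfolding E_def using submodule_smult[OF H xi] by (intro plus_mult_least[OF H KH])
    ultimately obtain a b where ab: "m \<le> a + b" "has_chain (plus_mult K (x [^] Suc i) H) E a"
        "has_chain E H b"
      using has_chain_split[OF Suc.prems E] by blast
    have "has_chain D H a"
    proof (rule has_chain_of_smult_image[OF ab(2) D H xi _ _ DH])
      show "K \<subseteq> plus_mult K (x [^] Suc i) H"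
        using plus_mult_superset[OF K H] x by (simp del: R.nat_pow_Suc)
      show "E \<subseteq> plus_mult K (x [^] i) H"
        by (simp add: E_def)
      fix d assume "d \<in> D"
      then obtain k h where kh: "k \<in> A" "h \<in> H" "d = k \<oplus>\<^bsub>M\<^esub> x \<odot>\<^bsub>M\<^esub> h"
        unfolding D_def by (rule plus_multE)
      have "(x [^] i) \<odot>\<^bsub>M\<^esub> d = (x [^] i) \<odot>\<^bsub>M\<^esub> k \<oplus>\<^bsub>M\<^esub> (x [^] Suc i) \<odot>\<^bsub>M\<^esub> h"
        using kh Suc_eq[OF kh(2)] xi x Hc submodule_mem[OF A]
        by (simp add: smult_r_distr del: R.nat_pow_Suc)
      moreover have "(x [^] i) \<odot>\<^bsub>M\<^esub> k \<in> K"
        using submodule_smult[OF K xi] kh AK by blast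
      ultimately show "(x [^] i) \<odot>\<^bsub>M\<^esub> d \<in> plus_mult K (x [^] Suc i) H"
        using kh by (simp add: plus_multI del: R.nat_pow_Suc)
    qed
    then have "a \<le> c"
      by (rule top)
    moreover have "b \<le> i * c"
      using ab(3) unfolding E_def by (rule Suc.IH)
    ultimately show ?case
      using ab(1) by simp
  qed
  have "plus_mult K (x [^] N) H = K"
    using plus_mult_least[OF K subset_refl N] plus_mult_superset[OF K H, of "x [^] N"] x by auto
  then have "m \<le> N * c" if "has_chain K H m" for m
    using filt[of N m] that by simp
  moreover have "has_chain K H 0"
    by (rule has_chain.refl[OF K H KH])
  ultimately obtain e where e: "has_chain K H e" and e_max: "\<And>m. has_chain K H m \<Longrightarrow> m \<le> e"
    using Greatest_le_nat[of "has_chain K H" _ "N * c"] GreatestI_nat[of "has_chain K H" 0 "N * c"]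
    by blast
  have "has_chain (plus_mult A x K) H (n + e)"
    by (rule has_chain_append[OF chain e])
  moreover have "plus_mult A x K \<subseteq> D"
    using KH by (auto simp: D_def plus_mult_def)
  ultimately obtain i j where ij: "n + e \<le> i + j" "has_chain (plus_mult A x K) D i" "has_chain D H j"
    using has_chain_split[OF _ D _ DH] by blast
  \<comment> \<open>\<open>(A + x H) / (A + x K)\<close> is an image of \<open>H / K\<close>.\<close>
  have "has_chain K H i"
  proof (rule has_chain_of_smult_image[OF ij(2) K H x _ _ KH])
    show "A \<subseteq> plus_mult A x K"
      by (rule plus_mult_superset[OF A K x])
    show "D \<subseteq> plus_mult A x H"
      by (simp add: D_def)
    show "x \<odot>\<^bsub>M\<^esub> k \<in> plus_mult A x K" if "k \<in> K" for k
      by (rule plus_mult_smult[OF A K x that])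
  qed
  then have "i \<le> e"
    by (rule e_max)
  then show ?thesis
    using ij(1) top[OF ij(3)] by simp
qed

end

section \<open>Several parameters\<close>

context noetherian_local_module
begin

text \<open>As \<open>M/B\<close> has finite length, two successive submodules \<open>B + y\<^sup>i M\<close> coincide, and both are then
  equal to \<open>B\<close> by Nakayama's lemma.\<close>

lemma power_maps_into_finite_colength:
  assumes B: "submodule B R M" and bound: "\<And>n. has_chain B (carrier M) n \<Longrightarrow> n \<le> c"
    and y: "y \<in> \<mm>"
  obtains n :: nat where "\<And>m. m \<in> carrier M \<Longrightarrow> (y [^] n) \<odot>\<^bsub>M\<^esub> m \<in> B"
proof -
  note C = carrier_is_submodule
  have yc: "y \<in> carrier R"
    using y Icarr by blast
  define E where "E i = plus_mult B (y [^] (i::nat)) (carrier M)" for i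
  have E: "submodule (E i) R M" for i
    unfolding E_def using yc by (intro plus_mult_submodule B C) simp
  have BE: "B \<subseteq> E i" for i
    unfolding E_def using yc by (intro plus_mult_superset B C) simp
  have smE: "(y [^] i) \<odot>\<^bsub>M\<^esub> m \<in> E i" if "m \<in> carrier M" for i m
    unfolding E_def using yc that by (intro plus_mult_smult B C) simp_all
  have Suc_eq: "(y [^] Suc i) \<odot>\<^bsub>M\<^esub> m = y \<odot>\<^bsub>M\<^esub> ((y [^] i) \<odot>\<^bsub>M\<^esub> m)"
    if "m \<in> carrier M" for i m
    using yc that by (simp add: smult_assoc1 smult_left_comm[of _ y])
  have decr: "E (Suc i) \<subseteq> E i" for i
  proof -
    have "(y [^] Suc i) \<odot>\<^bsub>M\<^esub> m \<in> E i" if "m \<in> carrier M" for m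
      using submodule_smult[OF E yc smE[OF that]] Suc_eq[OF that] by simp
    then show ?thesis
      unfolding E_def[of "Suc i"] by (intro plus_mult_least[OF E BE])
  qed
  have "\<exists>i. E (Suc i) = E i"
  proof (rule ccontr)
    assume "\<not> ?thesis"
    then have strict: "E (Suc i) \<subset> E i" for i
      using decr[of i] by blast
    have "has_chain (E i) (carrier M) i" for i
    proof (induction i)
      case 0
      show ?case
        using E C submodule_mem by (intro has_chain.refl) blast+
    next
      case (Suc i)
      show ?case
        by (rule has_chain.step[OF E strict Suc])
    qed
    then have "has_chain B (carrier M) (Suc c)"
      using has_chain_antimono B BE by blast
    then show False
      using bound by fastforce
  qed
  then obtain i where i: "E (Suc i) = E i" ..
  have "E (Suc i) \<subseteq> plus_mult B y (E i)"
    unfolding E_def[of "Suc i"]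
  proof (rule plus_mult_least)
    show "submodule (plus_mult B y (E i)) R M"
      by (rule plus_mult_submodule[OF B E yc])
    show "B \<subseteq> plus_mult B y (E i)"
      by (rule plus_mult_superset[OF B E yc])
    fix m assume m: "m \<in> carrier M"
    show "(y [^] Suc i) \<odot>\<^bsub>M\<^esub> m \<in> plus_mult B y (E i)"
      unfolding Suc_eq[OF m] by (rule plus_mult_smult[OF B E yc smE[OF m]])
  qed
  then have "E i \<subseteq> plus_mult B y (E i)"
    unfolding i .
  then have "E i \<subseteq> B"
    by (rule nakayama[OF B E y])
  then show ?thesis
    using that smE by blast
qed

text \<open>If \<open>X \<subseteq> P\<close>, then \<open>y\<^sup>n M \<subseteq> A + P M\<close> with \<open>y\<^sup>n \<notin> P\<close>, so \<open>M/K\<close> vanishes at \<open>P\<close> by Nakayama's lemma. But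
  \<open>P\<close> is the annihilator of an element of \<open>M/K\<close>.\<close>

lemma parameters_not_in_assoc_prime:
  assumes A: "submodule A R M" and K: "submodule K R M" and AK: "A \<subseteq> K" and X: "X \<subseteq> carrier R"
    and bound: "\<And>n. has_chain (plus_times A X) (carrier M) n \<Longrightarrow> n \<le> c"
    and y: "y \<in> \<mm>" "regular_mod K y" and P: "P \<in> assoc_primes K"
  shows "\<not> X \<subseteq> P"
proof
  assume XP: "X \<subseteq> P"
  obtain u where u: "u \<in> carrier M" "P = elem_colon K u" and prime: "primeideal P R"
    using P by (auto simp: assoc_primes_def)
  have yP: "y \<notin> P"
    using regular_not_in_assoc_prime[OF K y(2) P] .
  have yc: "y \<in> carrier R"
    using y Icarr by blast
  obtain n :: nat where n: "\<And>m. m \<in> carrier M \<Longrightarrow> (y [^] n) \<odot>\<^bsub>M\<^esub> m \<in> plus_times A X"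
    using power_maps_into_finite_colength[OF plus_times_submodule[OF A X] bound y(1)] by blast
  have pow: "y [^] k \<notin> P" for k :: nat
  proof (induction k)
    case 0
    show ?case
      using ideal.one_imp_carrier[OF primeideal.axioms(1)[OF prime]] primeideal.I_notcarr[OF prime]
      by auto
  next
    case (Suc k)
    have "y [^] k \<in> carrier R"
      using yc by simp
    from primeideal.I_prime[OF prime this yc] Suc yP show ?case by auto
  qed
  have "plus_times A X \<subseteq> gen (K \<union> {p \<odot>\<^bsub>M\<^esub> h | p h. p \<in> P \<and> h \<in> carrier M})"
    unfolding plus_times_def by (rule gen_mono) (use AK XP in blast)
  then have "(y [^] n) \<odot>\<^bsub>M\<^esub> m \<in> gen (K \<union> {p \<odot>\<^bsub>M\<^esub> h | p h. p \<in> P \<and> h \<in> carrier M})"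
    if "m \<in> carrier M" for m
    using n that by blast
  then obtain s where s: "s \<in> carrier R" "s \<notin> P" "\<And>m. m \<in> carrier M \<Longrightarrow> s \<odot>\<^bsub>M\<^esub> m \<in> K"
    using kill_outside_prime[OF prime K carrier_is_submodule _ pow] yc by blast
  then show False
    using u unfolding elem_colon_def by blast
qed

text \<open>Since \<open>x\<close> is regular on \<open>M/K\<close>, \<open>xM \<inter> K = xK\<close>. Generators of \<open>(K + xM)/(A + xM)\<close> can be moved into
  \<open>K\<close> by elements of \<open>xM\<close>; they then generate \<open>K\<close> modulo \<open>A + xK\<close>, hence modulo \<open>A\<close> by Nakayama's lemma.\<close>

lemma generators_from_regular_reduction:
  assumes A: "submodule A R M" and K: "submodule K R M" and AK: "A \<subseteq> K"
    and x: "x \<in> \<mm>" "regular_mod K x"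
    and S: "S \<subseteq> plus_times K {x}" "finite S" "card S \<le> c"
      "plus_times K {x} = gen (plus_times A {x} \<union> S)"
  shows "\<exists>T\<subseteq>K. finite T \<and> card T \<le> c \<and> K = gen (A \<union> T)"
proof -
  note C = carrier_is_submodule
  have xc: "x \<in> carrier R"
    using x Icarr by blast
  note Kc = submodule_mem[OF K]
  have "\<exists>k\<in>K. \<exists>m\<in>carrier M. s = k \<oplus>\<^bsub>M\<^esub> x \<odot>\<^bsub>M\<^esub> m" if "s \<in> S" for s
    using subsetD[OF S(1) that] K xc by (rule plus_times_singletonE) blast
  then obtain f where f: "\<And>s. s \<in> S \<Longrightarrow> f s \<in> K"
    "\<And>s. s \<in> S \<Longrightarrow> \<exists>m\<in>carrier M. s = f s \<oplus>\<^bsub>M\<^esub> x \<odot>\<^bsub>M\<^esub> m"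
    by metis
  define T where "T = f ` S"
  have T: "T \<subseteq> K" "finite T" "card T \<le> c"
    using f(1) S(2,3) card_image_le[OF S(2), of f] by (auto simp: T_def)
  define G where "G = gen (A \<union> T)"
  have G: "submodule G R M"
    unfolding G_def using AK T(1) Kc by (intro gen_submodule_submodule) blast
  have GK: "G \<subseteq> K"
    unfolding G_def by (rule gen_least[OF K]) (use AK T(1) in blast)
  have AG: "A \<subseteq> G" and TG: "T \<subseteq> G"
    unfolding G_def by (auto intro: genI)
  have Gx: "submodule (plus_mult G x (carrier M)) R M"
    by (rule plus_mult_submodule[OF G C xc])
  have "plus_times A {x} \<subseteq> plus_mult G x (carrier M)"
    unfolding plus_times_singleton[OF A xc] using AG by (auto simp: plus_mult_def)
  moreover have "S \<subseteq> plus_mult G x (carrier M)"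
  proof
    fix s assume s: "s \<in> S"
    then obtain m where "m \<in> carrier M" "s = f s \<oplus>\<^bsub>M\<^esub> x \<odot>\<^bsub>M\<^esub> m"
      using f(2) by blast
    moreover have "f s \<in> G"
      using s TG by (auto simp: T_def)
    ultimately show "s \<in> plus_mult G x (carrier M)"
      unfolding plus_mult_def by blast
  qed
  ultimately have le: "plus_times K {x} \<subseteq> plus_mult G x (carrier M)"
    unfolding S(4) by (intro gen_least[OF Gx]) blast
  have "K \<subseteq> plus_mult G x K"
  proof
    fix k assume k: "k \<in> K"
    have "k \<in> plus_mult G x (carrier M)"
      using k le plus_times_superset by blast
    then obtain g m where gm: "g \<in> G" "m \<in> carrier M" "k = g \<oplus>\<^bsub>M\<^esub> x \<odot>\<^bsub>M\<^esub> m"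
      by (rule plus_multE)
    have "x \<odot>\<^bsub>M\<^esub> m \<in> K"
      using submodule_add_cancel_left[OF K, of g "x \<odot>\<^bsub>M\<^esub> m"] gm k GK xc by blast
    then have "m \<in> K"
      using x(2) gm(2) by (simp add: regular_mod_def)
    then show "k \<in> plus_mult G x K"
      unfolding gm(3) using gm(1) by (intro plus_multI)
  qed
  then have "K \<subseteq> G"
    by (rule nakayama[OF G K x(1)])
  then have "K = gen (A \<union> T)"
    using GK unfolding G_def by blast
  then show ?thesis
    using T by blast
qed

text \<open>The bound for the submodule \<open>K/A\<close> of \<open>M/A\<close>, proved by induction on the parameters. Keeping \<open>A\<close>
  general is what lets the induction replace \<open>M\<close> by \<open>M/zM\<close>.\<close>

lemma generators_le_colength:
  assumes "submodule A R M" "submodule K R M" "A \<subseteq> K" "xs \<noteq> []" "set xs \<subseteq> \<mm>"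
    and "\<And>n. has_chain (plus_times A (set xs)) (carrier M) n \<Longrightarrow> n \<le> c"
    and "depth_ge (length xs - 1) K"
  shows "\<exists>S\<subseteq>K. finite S \<and> card S \<le> c \<and> K = gen (A \<union> S)"
  using assms
proof (induction xs arbitrary: A K)
  case Nil
  then show ?case by simp
next
  case (Cons x xs)
  note A = Cons.prems(1) and K = Cons.prems(2) and AK = Cons.prems(3)
  note C = carrier_is_submodule
  note bound = Cons.prems(6)
  have x: "x \<in> \<mm>" and xc: "x \<in> carrier R" and xs: "set xs \<subseteq> \<mm>" and xsc: "set xs \<subseteq> carrier R"
    using Cons.prems(5) Icarr by auto
  show ?case
  proof (cases "xs = []")
    case True
    have AxK: "submodule (plus_mult A x K) R M"
      by (rule plus_mult_submodule[OF A K xc])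
    have "plus_mult A x K \<subseteq> K"
      using submodule_smult[OF K xc] by (intro plus_mult_least[OF K AK])
    moreover have "n \<le> c" if "has_chain (plus_mult A x K) K n" for n
      using chains_submodule_one_parameter[OF A K AK xc _ that] bound True by simp
    ultimately have "\<exists>S\<subseteq>K. finite S \<and> card S \<le> c \<and> K = gen (plus_mult A x K \<union> S)"
      by (rule generators_of_bounded_chains[OF AxK K])
    then obtain S where S: "S \<subseteq> K" "finite S" "card S \<le> c" "K = gen (plus_mult A x K \<union> S)"
      by blast
    define G where "G = gen (A \<union> S)"
    have G: "submodule G R M"
      unfolding G_def using AK S(1) submodule_mem[OF K] by (intro gen_submodule_submodule) blast
    have AG: "A \<subseteq> G" and SG: "S \<subseteq> G"
      unfolding G_def by (auto intro: genI)
    have "plus_mult A x K \<subseteq> plus_mult G x K"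
      using AG by (auto simp: plus_mult_def)
    moreover have "S \<subseteq> plus_mult G x K"
      using SG plus_mult_superset[OF G K xc] by blast
    ultimately have "gen (plus_mult A x K \<union> S) \<subseteq> plus_mult G x K"
      by (intro gen_least plus_mult_submodule[OF G K xc]) blast
    then have "K \<subseteq> plus_mult G x K"
      using S(4) by simp
    then have "K \<subseteq> G"
      by (rule nakayama[OF G K x])
    moreover have "G \<subseteq> K"
      unfolding G_def by (rule gen_least[OF K]) (use AK S(1) in blast)
    ultimately have "K = gen (A \<union> S)"
      unfolding G_def by blast
    then show ?thesis
      using S by blast
  next
    case False
    then obtain n where n: "length xs = Suc n"
      by (cases xs) auto
    have depth: "depth_ge (Suc n) K"
      using Cons.prems(7) n by simp
    then obtain y where y: "y \<in> \<mm>" "regular_mod K y"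
      by auto
    define J where "J = Idl (set xs)"
    have J: "ideal J R" and xsJ: "set xs \<subseteq> J"
      unfolding J_def using R.genideal_ideal[OF xsc] R.genideal_self[OF xsc] by auto
    have "J \<subseteq> \<mm>"
      unfolding J_def by (rule R.genideal_minimal[OF is_ideal xs])
    have "\<not> J \<subseteq> P" if "P \<in> assoc_primes K" "x \<in> P" for P
    proof
      assume "J \<subseteq> P"
      then have "set (x # xs) \<subseteq> P"
        using that xsJ by auto
      moreover have "set (x # xs) \<subseteq> carrier R"
        using xc xsc by simp
      ultimately show False
        using parameters_not_in_assoc_prime[OF A K AK _ bound y that(1)] by blast
    qed
    then obtain j where j: "j \<in> J" and reg: "regular_mod K (x \<oplus> j)"
      using exists_regular_avoiding[of "{K}" J x] K J xc by blast
    \<comment> \<open>\<open>z\<close> replaces \<open>x\<close> among the parameters.\<close>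
    define z where "z = x \<oplus> j"
    have jc: "j \<in> carrier R"
      using ideal.Icarr[OF J j] .
    have z: "z \<in> \<mm>" "regular_mod K z" and zc: "z \<in> carrier R"
      using x j reg \<open>J \<subseteq> \<mm>\<close> xc jc a_closed unfolding z_def by auto
    define A' where "A' = plus_times A {z}"
    define K' where "K' = plus_times K {z}"
    have A': "submodule A' R M" and K': "submodule K' R M"
      unfolding A'_def K'_def using A K zc by (auto intro: plus_times_submodule)
    have A'K': "A' \<subseteq> K'"
      unfolding A'_def K'_def plus_times_def by (rule gen_mono) (use AK in blast)
    have "plus_times A (set (x # xs)) \<subseteq> plus_times A' (set xs)"
    proof (rule plus_times_least)
      have eq: "plus_times A' (set xs) = plus_times A ({z} \<union> set xs)"
        unfolding A'_def using zc xsc by (intro plus_times_plus_times[OF A]) auto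
      show U: "submodule (plus_times A' (set xs)) R M"
        by (rule plus_times_submodule[OF A' xsc])
      show "A \<subseteq> plus_times A' (set xs)"
        unfolding eq by (rule plus_times_superset)
      fix a m assume a: "a \<in> set (x # xs)" and m: "m \<in> carrier M"
      show "a \<odot>\<^bsub>M\<^esub> m \<in> plus_times A' (set xs)"
      proof (cases "a \<in> set xs")
        case True
        then show ?thesis
          using m by (rule plus_times_smult)
      next
        case False
        then have "a = x" using a by simp
        have "j \<odot>\<^bsub>M\<^esub> m \<in> plus_times A' (set xs)"
          using plus_times_smult[OF j m, of A'] unfolding J_def plus_times_Idl[OF A' xsc] .
        moreover have "x \<odot>\<^bsub>M\<^esub> m \<oplus>\<^bsub>M\<^esub> j \<odot>\<^bsub>M\<^esub> m \<in> plus_times A' (set xs)"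
          using plus_times_smult[of z "{z} \<union> set xs" m A] m xc jc
          unfolding eq by (simp add: z_def smult_l_distr)
        ultimately show ?thesis
          unfolding \<open>a = x\<close> using submodule_add_cancel_right[OF U] xc m by blast
      qed
    qed
    then have "k \<le> c" if "has_chain (plus_times A' (set xs)) (carrier M) k" for k
      using bound has_chain_antimono[OF that] plus_times_submodule[OF A, of "set (x # xs)"] xc xsc
      by auto
    moreover have "depth_ge (length xs - 1) K'"
      using depth_ge_exchange[OF K depth z] n by (simp add: K'_def)
    ultimately obtain S where "S \<subseteq> K'" "finite S" "card S \<le> c" "K' = gen (A' \<union> S)"
      using Cons.IH[OF A' K' A'K' False xs] by blast
    then show ?thesis
      unfolding A'_def K'_def by (rule generators_from_regular_reduction[OF A K AK z])
  qed
qed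

end

section \<open>Quotient modules, length and minimal numbers of generators\<close>

context module
begin

lemma submodule_abelian_subgroup:
  assumes "submodule N R M"
  shows "abelian_subgroup N M"
  using assms submodule.axioms(1)
  by (intro abelian_subgroupI3 M.abelian_group_axioms) (auto simp: additive_subgroup_def)

lemma quot_carrier: "A \<in> carrier (quot_module M N) \<longleftrightarrow> (\<exists>x\<in>carrier M. A = N +>\<^bsub>M\<^esub> x)"
  by (auto simp: quot_module_def A_RCOSETS_def')

lemma quot_coset_closed: "x \<in> carrier M \<Longrightarrow> N +>\<^bsub>M\<^esub> x \<in> carrier (quot_module M N)"
  using quot_carrier by blast

lemma quot_zero: "\<zero>\<^bsub>quot_module M N\<^esub> = N"
  by (simp add: quot_module_def)

lemma quot_add:
  assumes "submodule N R M" "x \<in> carrier M" "y \<in> carrier M"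
  shows "(N +>\<^bsub>M\<^esub> x) \<oplus>\<^bsub>quot_module M N\<^esub> (N +>\<^bsub>M\<^esub> y) = N +>\<^bsub>M\<^esub> (x \<oplus>\<^bsub>M\<^esub> y)"
  using abelian_subgroup.a_rcos_sum[OF submodule_abelian_subgroup[OF assms(1)]] assms
  by (simp add: quot_module_def)

lemma coset_eq_iff:
  assumes N: "submodule N R M" and x: "x \<in> carrier M" and y: "y \<in> carrier M"
  shows "N +>\<^bsub>M\<^esub> x = N +>\<^bsub>M\<^esub> y \<longleftrightarrow> x \<ominus>\<^bsub>M\<^esub> y \<in> N"
proof -
  interpret N: abelian_subgroup N M
    using N by (rule submodule_abelian_subgroup)
  have "x \<ominus>\<^bsub>M\<^esub> y \<in> N \<longleftrightarrow> x \<in> N +>\<^bsub>M\<^esub> y"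
    using N.a_rcos_module[OF y x] by (simp add: a_minus_def)
  also have "\<dots> \<longleftrightarrow> N +>\<^bsub>M\<^esub> x = N +>\<^bsub>M\<^esub> y"
    using N.a_repr_independence'[of x y] N.a_rcos_self[OF x] y by metis
  finally show ?thesis by simp
qed

lemma coset_eq_self_iff:
  assumes N: "submodule N R M" and x: "x \<in> carrier M"
  shows "N +>\<^bsub>M\<^esub> x = N \<longleftrightarrow> x \<in> N"
proof -
  have "N +>\<^bsub>M\<^esub> \<zero>\<^bsub>M\<^esub> = N"
    using submodule_mem[OF N] by (intro M.a_coset_add_zero) blast
  moreover have "x \<ominus>\<^bsub>M\<^esub> \<zero>\<^bsub>M\<^esub> = x"
    using diff_add_cancel[OF x M.zero_closed] x by simp
  ultimately show ?thesis
    using coset_eq_iff[OF N x M.zero_closed] by simp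
qed

lemma quot_smult:
  assumes N: "submodule N R M" and a: "a \<in> carrier R" and x: "x \<in> carrier M"
  shows "a \<odot>\<^bsub>quot_module M N\<^esub> (N +>\<^bsub>M\<^esub> x) = N +>\<^bsub>M\<^esub> (a \<odot>\<^bsub>M\<^esub> x)"
proof -
  interpret N: abelian_subgroup N M
    using N by (rule submodule_abelian_subgroup)
  have "N +>\<^bsub>M\<^esub> (a \<odot>\<^bsub>M\<^esub> y) = N +>\<^bsub>M\<^esub> (a \<odot>\<^bsub>M\<^esub> x)" if y: "y \<in> N +>\<^bsub>M\<^esub> x" for y
  proof -
    have yc: "y \<in> carrier M"
      using y N.a_elemrcos_carrier[OF x] by blast
    have "N +>\<^bsub>M\<^esub> y = N +>\<^bsub>M\<^esub> x"
      using N.a_repr_independence'[OF y x] by simp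
    then have "a \<odot>\<^bsub>M\<^esub> (y \<ominus>\<^bsub>M\<^esub> x) \<in> N"
      using coset_eq_iff[OF N yc x] submodule_smult[OF N a] by blast
    then show ?thesis
      using coset_eq_iff[OF N, of "a \<odot>\<^bsub>M\<^esub> y" "a \<odot>\<^bsub>M\<^esub> x"] a x yc by (simp add: smult_r_diff)
  qed
  moreover have "x \<in> N +>\<^bsub>M\<^esub> x"
    using x by (rule N.a_rcos_self)
  ultimately have "(\<Union>y\<in>N +>\<^bsub>M\<^esub> x. N +>\<^bsub>M\<^esub> (a \<odot>\<^bsub>M\<^esub> y)) = N +>\<^bsub>M\<^esub> (a \<odot>\<^bsub>M\<^esub> x)"
    by blast
  then show ?thesis
    by (simp add: quot_module_def)
qed

definition quot_image :: "'c set \<Rightarrow> 'c set \<Rightarrow> 'c set set"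
  where "quot_image N Z = (\<lambda>z. N +>\<^bsub>M\<^esub> z) ` Z"

lemma quot_image_iff:
  assumes N: "submodule N R M" and Z: "submodule Z R M" and "N \<subseteq> Z" and m: "m \<in> carrier M"
  shows "N +>\<^bsub>M\<^esub> m \<in> quot_image N Z \<longleftrightarrow> m \<in> Z"
proof
  assume "N +>\<^bsub>M\<^esub> m \<in> quot_image N Z"
  then obtain z where z: "z \<in> Z" "N +>\<^bsub>M\<^esub> m = N +>\<^bsub>M\<^esub> z"
    by (auto simp: quot_image_def)
  then have "m \<ominus>\<^bsub>M\<^esub> z \<in> N"
    using coset_eq_iff[OF N m] submodule_mem[OF Z] by blast
  then show "m \<in> Z"
    using submodule_diff_cancel[OF Z z(1) m] assms(3) by blast
qed (simp add: quot_image_def)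

lemma quot_image_submodule:
  assumes N: "submodule N R M" and Z: "submodule Z R M"
  shows "submodule (quot_image N Z) R (quot_module M N)"
proof -
  interpret Q: module R "quot_module M N"
    by (rule quot_module_module[OF N])
  note Zc = submodule_mem[OF Z]
  have smult: "a \<odot>\<^bsub>quot_module M N\<^esub> A \<in> quot_image N Z"
    if a: "a \<in> carrier R" and "A \<in> quot_image N Z" for a A
  proof -
    obtain z where z: "z \<in> Z" "A = N +>\<^bsub>M\<^esub> z"
      using \<open>A \<in> quot_image N Z\<close> by (auto simp: quot_image_def)
    then show ?thesis
      using quot_smult[OF N a Zc] submodule_smult[OF Z a] by (simp add: quot_image_def)
  qed
  have sub: "quot_image N Z \<subseteq> carrier (quot_module M N)"
    using Zc quot_coset_closed by (auto simp: quot_image_def)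
  show ?thesis
  proof (rule Q.submoduleI[OF sub])
    have "N +>\<^bsub>M\<^esub> \<zero>\<^bsub>M\<^esub> = N"
      using coset_eq_self_iff[OF N M.zero_closed] submodule_zero[OF N] by simp
    then show "\<zero>\<^bsub>quot_module M N\<^esub> \<in> quot_image N Z"
      using submodule_zero[OF Z] unfolding quot_zero quot_image_def by force
    show "\<ominus>\<^bsub>quot_module M N\<^esub> A \<in> quot_image N Z" if A: "A \<in> quot_image N Z" for A
    proof -
      have "\<ominus>\<^bsub>quot_module M N\<^esub> A = (\<ominus> \<one>) \<odot>\<^bsub>quot_module M N\<^esub> A"
        using A sub Q.smult_l_minus[of \<one> A] by auto
      then show ?thesis
        using smult[OF _ A] by simp
    qed
    fix A B assume "A \<in> quot_image N Z" "B \<in> quot_image N Z"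
    then show "A \<oplus>\<^bsub>quot_module M N\<^esub> B \<in> quot_image N Z"
      using quot_add[OF N] submodule_add[OF Z] Zc by (auto simp: quot_image_def)
  qed (rule smult)
qed

lemma quot_preimage_submodule:
  assumes N: "submodule N R M" and I: "submodule I R (quot_module M N)"
  shows "submodule {m \<in> carrier M. N +>\<^bsub>M\<^esub> m \<in> I} R M"
proof -
  interpret Q: module R "quot_module M N"
    by (rule quot_module_module[OF N])
  have smult: "N +>\<^bsub>M\<^esub> (a \<odot>\<^bsub>M\<^esub> m) \<in> I" if "a \<in> carrier R" "m \<in> carrier M" "N +>\<^bsub>M\<^esub> m \<in> I" for a m
    using Q.submodule_smult[OF I that(1,3)] quot_smult[OF N that(1,2)] by simp
  show ?thesis
  proof (rule submoduleI)
    have "N +>\<^bsub>M\<^esub> \<zero>\<^bsub>M\<^esub> = N"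
      using coset_eq_self_iff[OF N M.zero_closed] submodule_zero[OF N] by simp
    then show "\<zero>\<^bsub>M\<^esub> \<in> {m \<in> carrier M. N +>\<^bsub>M\<^esub> m \<in> I}"
      using Q.submodule_zero[OF I] by (simp add: quot_zero)
    show "\<ominus>\<^bsub>M\<^esub> m \<in> {m \<in> carrier M. N +>\<^bsub>M\<^esub> m \<in> I}" if "m \<in> {m \<in> carrier M. N +>\<^bsub>M\<^esub> m \<in> I}" for m
      using that smult[of "\<ominus> \<one>" m] smult_l_minus[of \<one> m] by simp
    show "a \<oplus>\<^bsub>M\<^esub> b \<in> {m \<in> carrier M. N +>\<^bsub>M\<^esub> m \<in> I}"
      if "a \<in> {m \<in> carrier M. N +>\<^bsub>M\<^esub> m \<in> I}" "b \<in> {m \<in> carrier M. N +>\<^bsub>M\<^esub> m \<in> I}" for a b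
      using that Q.submodule_add[OF I, of "N +>\<^bsub>M\<^esub> a" "N +>\<^bsub>M\<^esub> b"] quot_add[OF N, of a b] by simp
  qed (auto intro: smult)
qed

text \<open>\<open>J (M/N) = (N + J M)/N\<close>. This turns the iterated quotients in the definition of a regular sequence
  on \<open>M/N\<close> into statements about submodules of \<open>M\<close>.\<close>

lemma coset_mem_ideal_times_quot_iff:
  assumes N: "submodule N R M" and J: "J \<subseteq> carrier R" and m: "m \<in> carrier M"
  shows "N +>\<^bsub>M\<^esub> m \<in> ideal_times R J (quot_module M N) \<longleftrightarrow> m \<in> plus_times N J"
proof -
  interpret Q: module R "quot_module M N"
    by (rule quot_module_module[OF N])
  define Z where "Z = plus_times N J"
  define I where "I = ideal_times R J (quot_module M N)"
  have Z: "submodule Z R M" "N \<subseteq> Z"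
    unfolding Z_def by (rule plus_times_submodule[OF N J], rule plus_times_superset)
  have I: "submodule I R (quot_module M N)"
    unfolding I_def by (rule Q.ideal_times_submodule[OF J])
  have "I \<subseteq> quot_image N Z"
    unfolding I_def ideal_times_def
  proof (rule Q.gen_least[OF quot_image_submodule[OF N Z(1)]], safe)
    fix a A assume a: "a \<in> J" "A \<in> carrier (quot_module M N)"
    then obtain x where x: "x \<in> carrier M" "A = N +>\<^bsub>M\<^esub> x"
      using quot_carrier by blast
    then show "a \<odot>\<^bsub>quot_module M N\<^esub> A \<in> quot_image N Z"
      using quot_smult[OF N, of a x] a J plus_times_smult[of a J x N]
      by (auto simp: quot_image_def Z_def)
  qed
  moreover have "plus_times N J \<subseteq> {m \<in> carrier M. N +>\<^bsub>M\<^esub> m \<in> I}"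
  proof (rule plus_times_least[OF quot_preimage_submodule[OF N I]])
    show "N \<subseteq> {m \<in> carrier M. N +>\<^bsub>M\<^esub> m \<in> I}"
    proof
      fix h assume h: "h \<in> N"
      then have hc: "h \<in> carrier M"
        using submodule_mem[OF N] by blast
      then have "N +>\<^bsub>M\<^esub> h = N"
        using h coset_eq_self_iff[OF N] by blast
      then show "h \<in> {m \<in> carrier M. N +>\<^bsub>M\<^esub> m \<in> I}"
        using hc Q.submodule_zero[OF I] by (simp add: quot_zero)
    qed
    fix a x assume a: "a \<in> J" and x: "x \<in> carrier M"
    have "a \<odot>\<^bsub>quot_module M N\<^esub> (N +>\<^bsub>M\<^esub> x) \<in> I"
      unfolding I_def ideal_times_def
      by (rule Q.genI) (use a quot_coset_closed[OF x] in blast)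
    then show "a \<odot>\<^bsub>M\<^esub> x \<in> {m \<in> carrier M. N +>\<^bsub>M\<^esub> m \<in> I}"
      using quot_smult[OF N _ x] a J x by auto
  qed
  ultimately show ?thesis
    using quot_image_iff[OF N Z m] unfolding I_def Z_def by blast
qed

lemma nonzerodivisor_on_quot_iff:
  assumes N: "submodule N R M" and a: "a \<in> carrier R"
  shows "nonzerodivisor_on (quot_module M N) a \<longleftrightarrow> (\<forall>m\<in>carrier M. a \<odot>\<^bsub>M\<^esub> m \<in> N \<longrightarrow> m \<in> N)"
proof -
  have "nonzerodivisor_on (quot_module M N) a \<longleftrightarrow>
    (\<forall>m\<in>carrier M. a \<odot>\<^bsub>quot_module M N\<^esub> (N +>\<^bsub>M\<^esub> m) = N \<longrightarrow> N +>\<^bsub>M\<^esub> m = N)"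
    unfolding nonzerodivisor_on_def quot_zero using quot_carrier by metis
  also have "\<dots> \<longleftrightarrow> (\<forall>m\<in>carrier M. a \<odot>\<^bsub>M\<^esub> m \<in> N \<longrightarrow> m \<in> N)"
    using quot_smult[OF N a] coset_eq_self_iff[OF N] a by (intro ball_cong) auto
  finally show ?thesis .
qed

lemma nonzerodivisor_on_quot_quot:
  assumes N: "submodule N R M" and X: "X \<subseteq> carrier R" and a: "a \<in> carrier R"
    and nzd: "nonzerodivisor_on
      (quot_module (quot_module M N) (ideal_times R (Idl\<^bsub>R\<^esub> X) (quot_module M N))) a"
    and m: "m \<in> carrier M" "a \<odot>\<^bsub>M\<^esub> m \<in> plus_times N X"
  shows "m \<in> plus_times N X"
proof -
  interpret Q: module R "quot_module M N"
    by (rule quot_module_module[OF N])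
  have J: "Idl\<^bsub>R\<^esub> X \<subseteq> carrier R"
    using ideal.Icarr[OF R.genideal_ideal[OF X]] by blast
  have mem: "N +>\<^bsub>M\<^esub> k \<in> ideal_times R (Idl\<^bsub>R\<^esub> X) (quot_module M N) \<longleftrightarrow> k \<in> plus_times N X"
    if "k \<in> carrier M" for k
    using coset_mem_ideal_times_quot_iff[OF N J that] plus_times_Idl[OF N X] by simp
  have "a \<odot>\<^bsub>quot_module M N\<^esub> (N +>\<^bsub>M\<^esub> m) \<in> ideal_times R (Idl\<^bsub>R\<^esub> X) (quot_module M N)"
    using mem[of "a \<odot>\<^bsub>M\<^esub> m"] quot_smult[OF N a m(1)] m a by simp
  then show ?thesis
    using nzd[unfolded Q.nonzerodivisor_on_quot_iff[OF Q.ideal_times_submodule[OF J] a]]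
      quot_coset_closed[OF m(1)] mem[OF m(1)] by blast
qed

lemma has_chain_function:
  assumes "has_chain B H n"
  shows "\<exists>C. (\<forall>i\<le>n. submodule (C i) R M \<and> B \<subseteq> C i) \<and> (\<forall>i<n. C i \<subset> C (Suc i))"
proof -
  have "\<exists>C. C 0 = B \<and> (\<forall>i\<le>n. submodule (C i) R M \<and> B \<subseteq> C i) \<and> (\<forall>i<n. C i \<subset> C (Suc i))"
    using assms
  proof (induction rule: has_chain.induct)
    case (refl B H)
    then show ?case by (intro exI[of _ "\<lambda>_. B"]) simp
  next
    case (step B B' H n)
    then obtain C where C: "C 0 = B'" "\<forall>i\<le>n. submodule (C i) R M \<and> B' \<subseteq> C i"
      "\<forall>i<n. C i \<subset> C (Suc i)"
      by blast
    have "B \<subseteq> C i" if "i \<le> n" for i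
      using C(2) that step.hyps(2) by blast
    then show ?case
      using step.hyps(1,2) C
      by (intro exI[of _ "case_nat B C"]) (auto split: nat.split simp: less_Suc_eq_0_disj)
  qed
  then show ?thesis by blast
qed

text \<open>Submodules of \<open>M\<close> between \<open>B\<close> and \<open>M\<close> correspond to submodules of \<open>M/B\<close>.\<close>

lemma has_chain_le_length_quot:
  assumes ch: "has_chain B (carrier M) n"
  shows "enat n \<le> module_length R (quot_module M B)"
proof -
  have B: "submodule B R M"
    using has_chainD[OF ch] by simp
  obtain C where C: "\<And>i. i \<le> n \<Longrightarrow> submodule (C i) R M" "\<And>i. i \<le> n \<Longrightarrow> B \<subseteq> C i"
    and strict: "\<And>i. i < n \<Longrightarrow> C i \<subset> C (Suc i)"
    using has_chain_function[OF ch] by blast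
  have "submodule (quot_image B (C i)) R (quot_module M B)" if "i \<le> n" for i
    using quot_image_submodule[OF B C(1)[OF that]] .
  moreover have "quot_image B (C i) \<subset> quot_image B (C (Suc i))" if i: "i < n" for i
  proof -
    obtain z where z: "z \<in> C (Suc i)" "z \<notin> C i"
      using strict[OF i] by blast
    have zc: "z \<in> carrier M"
      using z(1) C(1)[of "Suc i"] i submodule_mem by (meson Suc_leI)
    have "B +>\<^bsub>M\<^esub> z \<notin> quot_image B (C i)"
      using quot_image_iff[OF B C(1) C(2) zc, of i] i z(2) by simp
    moreover have "B +>\<^bsub>M\<^esub> z \<in> quot_image B (C (Suc i))"
      using z(1) by (simp add: quot_image_def)
    moreover have "quot_image B (C i) \<subseteq> quot_image B (C (Suc i))"
      using strict[OF i] by (auto simp: quot_image_def)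
    ultimately show ?thesis by blast
  qed
  ultimately show ?thesis
    unfolding module_length_def
    by (intro Sup_upper CollectI exI[of _ n] conjI refl exI[of _ "\<lambda>i. quot_image B (C i)"]) auto
qed

lemma min_gens_submodule_le:
  assumes N: "submodule N R M" and S: "S \<subseteq> N" "finite S" "N = gen S"
  shows "min_gens R (M\<lparr>carrier := N\<rparr>) \<le> enat (card S)"
proof -
  have modN: "module R (M\<lparr>carrier := N\<rparr>)"
    using submodule.submodule_is_module[OF N] module_axioms by blast
  have "gen_submodule R (M\<lparr>carrier := N\<rparr>) S = N"
  proof
    show "gen_submodule R (M\<lparr>carrier := N\<rparr>) S \<subseteq> N"
      using module.gen_closed[OF modN] S(1) by simp
    have "N \<subseteq> H" if H: "submodule H R (M\<lparr>carrier := N\<rparr>)" and SH: "S \<subseteq> H" for H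
    proof -
      have HN: "H \<subseteq> N" and smult: "\<And>a h. a \<in> carrier R \<Longrightarrow> h \<in> H \<Longrightarrow> a \<odot>\<^bsub>M\<^esub> h \<in> H"
        using module.submoduleE(1,4)[OF modN H] by simp_all
      have "submodule H R M"
      proof (rule submoduleI)
        show "H \<subseteq> carrier M"
          using HN submodule_mem[OF N] by blast
        show "\<zero>\<^bsub>M\<^esub> \<in> H"
          using module.submodule_zero[OF modN H] by simp
        show "\<ominus>\<^bsub>M\<^esub> h \<in> H" if "h \<in> H" for h
          using smult[of "\<ominus> \<one>" h] smult_l_minus[of \<one> h] that HN submodule_mem[OF N] by auto
        show "a \<oplus>\<^bsub>M\<^esub> b \<in> H" if "a \<in> H" "b \<in> H" for a b
          using module.submodule_add[OF modN H that] by simp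
      qed (rule smult)
      then show ?thesis
        unfolding S(3) using SH by (rule gen_least)
    qed
    then show "N \<subseteq> gen_submodule R (M\<lparr>carrier := N\<rparr>) S"
      unfolding gen_submodule_def by blast
  qed
  then show ?thesis
    unfolding min_gens_def using S by (intro Inf_lower) auto
qed

end

section \<open>Depth of quotient modules\<close>

context noetherian_local_module
begin

lemma depth_ge_carrier: "depth_ge n (carrier M)"
proof (induction n)
  case (Suc n)
  have "plus_times (carrier M) {\<zero>} = carrier M"
    using plus_times_superset plus_times_least[OF carrier_is_submodule, of "carrier M" "{\<zero>}"]
    by (intro equalityI) auto
  then show ?case
    using Suc zero_closed by (auto simp: regular_mod_def intro!: bexI[of _ \<zero>])
qed simp

lemma depth_ge_of_regular_sequence:
  assumes N: "submodule N R M" and ys: "set ys \<subseteq> \<mm>"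
    and reg: "regular_sequence R (quot_module M N) ys"
  shows "n + i \<le> length ys \<Longrightarrow> depth_ge n (plus_times N (set (take i ys)))"
proof (induction n arbitrary: i)
  case (Suc n)
  have i: "i < length ys"
    using Suc.prems by simp
  have ysc: "set ys \<subseteq> carrier R"
    using ys Icarr by blast
  have takec: "set (take i ys) \<subseteq> carrier R" and yc: "ys ! i \<in> carrier R" and ym: "ys ! i \<in> \<mm>"
    using ys ysc i set_take_subset[of i ys] nth_mem[OF i] by blast+
  have nzd: "nonzerodivisor_on (quot_module (quot_module M N)
      (ideal_times R (Idl (set (take i ys))) (quot_module M N))) (ys ! i)"
    using reg i by (simp add: regular_sequence_def)
  then have "regular_mod (plus_times N (set (take i ys))) (ys ! i)"
    unfolding regular_mod_def using nonzerodivisor_on_quot_quot[OF N takec yc nzd] by blast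
  moreover have "plus_times (plus_times N (set (take i ys))) {ys ! i} = plus_times N (set (take (Suc i) ys))"
    using plus_times_plus_times[OF N takec, of "{ys ! i}"] yc i by (simp add: take_Suc_conv_app_nth)
  ultimately show ?case
    using Suc.IH[of "Suc i"] Suc.prems ym by auto
qed simp

lemma depth_ge_of_depth:
  assumes N: "submodule N R M" and depth: "depth R \<mm> (quot_module M N) \<ge> enat n"
  shows "depth_ge n N"
proof (cases "carrier (quot_module M N) = {\<zero>\<^bsub>quot_module M N\<^esub>}")
  case True
  have "m \<in> N" if m: "m \<in> carrier M" for m
    using quot_coset_closed[OF m, of N] True coset_eq_self_iff[OF N m] unfolding quot_zero by auto
  then have "N = carrier M"
    using submodule_mem[OF N] by blast
  then show ?thesis
    using depth_ge_carrier by simp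
next
  case False
  show ?thesis
  proof (cases n)
    case (Suc k)
    have "enat k < Sup {enat (length ys) | ys. set ys \<subseteq> \<mm> \<and> regular_sequence R (quot_module M N) ys}"
      using depth False Suc by (simp add: depth_def Suc_ile_eq)
    then obtain ys where ys: "set ys \<subseteq> \<mm>" "regular_sequence R (quot_module M N) ys" "k < length ys"
      unfolding less_Sup_iff by auto
    have "plus_times N {} = N"
      using gen_of_submodule[OF N] by (simp add: plus_times_def)
    then show ?thesis
      using depth_ge_of_regular_sequence[OF N ys(1,2), of n 0] ys(3) Suc by simp
  qed simp
qed

end

theorem corollary4:
  fixes R :: "('a, 'r) ring_scheme" and M :: "('a, 'b, 'm) module_scheme"
    and \<mm> \<qq> :: "'a set" and N :: "'b set" and xs :: "'a list" and d :: nat and c :: enat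
  assumes "local_ring R \<mm>" and "noetherian_ring R"
    and "module R M" and "finitely_generated R M"
    and "module_dim R M = enat d" and "1 \<le> d"
    and "system_of_parameters R \<mm> M xs" and "\<qq> = Idl\<^bsub>R\<^esub> (set xs)"
    and "c = module_length R (quot_module M (ideal_times R \<qq> M))"
    and "submodule N R M"
    and "depth R \<mm> (quot_module M N) \<ge> enat (d - 1)"
  shows "min_gens R (M\<lparr>carrier := N\<rparr>) \<le> c"
proof -
  interpret noetherian_local_module R M \<mm>
    by (intro noetherian_local_module.intro fg_noetherian_module.intro
        fg_noetherian_module_axioms.intro assms(1-4))
  note N = \<open>submodule N R M\<close>
  \<comment> \<open>\<open>\<ell>(M/\<qq>M)\<close> is finite, so it is a natural number that bounds the chains above \<open>\<qq>M\<close>.\<close>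
  have xs: "set xs \<subseteq> \<mm>" "length xs = d" and fin: "c < \<infinity>"
    using assms(5,7,8,9) by (auto simp: system_of_parameters_def)
  obtain k where k: "c = enat k"
    using fin by auto
  have xsc: "set xs \<subseteq> carrier R"
    using xs(1) Icarr by blast
  have Z: "submodule {\<zero>\<^bsub>M\<^esub>} R M"
    by (rule submoduleI) auto
  have "Idl\<^bsub>R\<^esub> (set xs) \<subseteq> carrier R"
    using ideal.Icarr[OF R.genideal_ideal[OF xsc]] by blast
  then have "ideal_times R \<qq> M = plus_times {\<zero>\<^bsub>M\<^esub>} (set xs)"
    unfolding assms(8) plus_times_Idl[OF Z xsc, symmetric] by (rule ideal_times_eq_plus_times)
  then have "n \<le> k" if "has_chain (plus_times {\<zero>\<^bsub>M\<^esub>} (set xs)) (carrier M) n" for n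
  proof -
    have "enat n \<le> enat k"
      using has_chain_le_length_quot[OF that] \<open>ideal_times R \<qq> M = _\<close> assms(9) k by metis
    then show ?thesis by simp
  qed
  moreover have "depth_ge (length xs - 1) N"
    using depth_ge_of_depth[OF N assms(11)] xs(2) by simp
  moreover have "xs \<noteq> []"
    using xs(2) \<open>1 \<le> d\<close> by auto
  moreover have "{\<zero>\<^bsub>M\<^esub>} \<subseteq> N"
    using submodule_zero[OF N] by simp
  ultimately have "\<exists>S\<subseteq>N. finite S \<and> card S \<le> k \<and> N = gen ({\<zero>\<^bsub>M\<^esub>} \<union> S)"
    by (intro generators_le_colength[OF Z N _ _ xs(1)])
  then obtain S where S: "S \<subseteq> N" "finite S" "card S \<le> k" "N = gen ({\<zero>\<^bsub>M\<^esub>} \<union> S)"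
    by blast
  have Sc: "S \<subseteq> carrier M"
    using S(1) submodule_mem[OF N] by blast
  have "gen ({\<zero>\<^bsub>M\<^esub>} \<union> S) = gen S"
    using submodule_zero[OF gen_submodule_submodule[OF Sc]] gen_superset[of S]
    by (intro equalityI gen_least gen_submodule_submodule Sc gen_mono) auto
  then have "min_gens R (M\<lparr>carrier := N\<rparr>) \<le> enat (card S)"
    using min_gens_submodule_le[OF N S(1,2)] S(4) by simp
  also have "\<dots> \<le> c"
    using S(3) k by simp
  finally show ?thesis .
qed

end
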